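(* Let $G$ be a finitely generated group and let $H$ be a commensurated subgroup of $G$. If there is an $H$-proper $H$-almost invariant subset $A\subseteq G$ such that $AH=A$, then $G$ splits nontrivially over a subgroup commensurable with $H$.
   Context: $H\le G$ is commensurated in $G$ if for every $g\in G$ the intersection $H\cap gHg^{-1}$ has finite index in both $H$ and $gHg^{-1}$. A subset of $G$ is $H$-finite if it is contained in finitely many right cosets $Hg$ of $H$. $A\subseteq G$ is $H$-proper if neither $A$ nor $A^*=G\smallsetminus A$ is $H$-finite. $A$ is $H$-almost invariant if for every $g\in G$ the symmetric difference of $A$ and $Ag$ is $H$-finite. $G$ splits nontrivially over a subgroup $C$ if $G$ is an amalgamated free product $G=P*_C Q$ with $P\neq C\neq Q$, or an HNN-extension $G=P*_C$. Two subgroups of $G$ are commensurable if their intersection has finite index in both. *)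

theory Defs
  imports "HOL-Algebra.Generated_Groups"
begin

section \<open>Commensurability and almost invariant sets\<close>

definition finitely_generated_group :: "('a, 'b) monoid_scheme \<Rightarrow> bool" where
  "finitely_generated_group G \<longleftrightarrow>
     group G \<and> (\<exists>S. finite S \<and> S \<subseteq> carrier G \<and> generate G S = carrier G)"

text \<open>\<open>finite_index G K L\<close>: \<open>K\<close> is a subgroup of finite index in the subgroup \<open>L\<close> of \<open>G\<close>.\<close>

definition finite_index :: "('a, 'b) monoid_scheme \<Rightarrow> 'a set \<Rightarrow> 'a set \<Rightarrow> bool" where
  "finite_index G K L \<longleftrightarrow>
     subgroup K (G\<lparr>carrier := L\<rparr>) \<and> finite (rcosets\<^bsub>G\<lparr>carrier := L\<rparr>\<^esub> K)"

definition commensurable :: "('a, 'b) monoid_scheme \<Rightarrow> 'a set \<Rightarrow> 'a set \<Rightarrow> bool" where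
  "commensurable G H K \<longleftrightarrow> finite_index G (H \<inter> K) H \<and> finite_index G (H \<inter> K) K"

definition commensurated :: "('a, 'b) monoid_scheme \<Rightarrow> 'a set \<Rightarrow> bool" where
  "commensurated G H \<longleftrightarrow>
     subgroup H G \<and> (\<forall>g\<in>carrier G. commensurable G H (g <#\<^bsub>G\<^esub> H #>\<^bsub>G\<^esub> inv\<^bsub>G\<^esub> g))"

definition H_finite :: "('a, 'b) monoid_scheme \<Rightarrow> 'a set \<Rightarrow> 'a set \<Rightarrow> bool" where
  "H_finite G H A \<longleftrightarrow> (\<exists>\<F>. finite \<F> \<and> \<F> \<subseteq> rcosets\<^bsub>G\<^esub> H \<and> A \<subseteq> \<Union>\<F>)"

definition H_proper :: "('a, 'b) monoid_scheme \<Rightarrow> 'a set \<Rightarrow> 'a set \<Rightarrow> bool" where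
  "H_proper G H A \<longleftrightarrow> \<not> H_finite G H A \<and> \<not> H_finite G H (carrier G - A)"

definition H_almost_invariant :: "('a, 'b) monoid_scheme \<Rightarrow> 'a set \<Rightarrow> 'a set \<Rightarrow> bool" where
  "H_almost_invariant G H A \<longleftrightarrow>
     (\<forall>g\<in>carrier G. H_finite G H ((A - (A #>\<^bsub>G\<^esub> g)) \<union> ((A #>\<^bsub>G\<^esub> g) - A)))"

section \<open>Presentations\<close>

text \<open>
  \<open>word_cong X R\<close> is the congruence on the free monoid of words over the alphabet \<open>X\<close> generated
  by the pairs \<open>R\<close>, and \<open>presented X R\<close> is the quotient.  In the two uses
  below the relations make every letter invertible, so this monoid is a group, and it is the
  group given by the corresponding group presentation.
\<close>

inductive_set word_cong :: "'l set \<Rightarrow> ('l list \<times> 'l list) set \<Rightarrow> ('l list \<times> 'l list) set"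
  for X :: "'l set" and R :: "('l list \<times> 'l list) set" where
  rel: "(u, v) \<in> R \<Longrightarrow> u \<in> lists X \<Longrightarrow> v \<in> lists X \<Longrightarrow> x \<in> lists X \<Longrightarrow> y \<in> lists X \<Longrightarrow>
    (x @ u @ y, x @ v @ y) \<in> word_cong X R"
| refl: "u \<in> lists X \<Longrightarrow> (u, u) \<in> word_cong X R"
| sym: "(u, v) \<in> word_cong X R \<Longrightarrow> (v, u) \<in> word_cong X R"
| trans: "(u, v) \<in> word_cong X R \<Longrightarrow> (v, w) \<in> word_cong X R \<Longrightarrow> (u, w) \<in> word_cong X R"

definition word_class :: "'l set \<Rightarrow> ('l list \<times> 'l list) set \<Rightarrow> 'l list \<Rightarrow> 'l list set" where
  "word_class X R u = word_cong X R `` {u}"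

definition presented :: "'l set \<Rightarrow> ('l list \<times> 'l list) set \<Rightarrow> 'l list set monoid" where
  "presented X R =
     \<lparr>carrier = lists X // word_cong X R,
      mult = (\<lambda>U V. \<Union>u\<in>U. \<Union>v\<in>V. word_class X R (u @ v)),
      one = word_class X R []\<rparr>"

text \<open>The multiplication table of \<open>K\<close>, with \<open>f\<close> naming the letter of each element.\<close>

definition table_rels :: "('k, 'x) monoid_scheme \<Rightarrow> ('k \<Rightarrow> 'l) \<Rightarrow> ('l list \<times> 'l list) set" where
  "table_rels K f =
     insert ([f \<one>\<^bsub>K\<^esub>], [])
       {([f x, f y], [f (x \<otimes>\<^bsub>K\<^esub> y)]) | x y. x \<in> carrier K \<and> y \<in> carrier K}"

section \<open>Amalgamated free products\<close>

text \<open>\<open>K *\<^sub>C L\<close> for embeddings \<open>i\<close> and \<open>j\<close> of \<open>C\<close> into \<open>K\<close> and \<open>L\<close>.\<close>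

definition amalgam_alphabet ::
    "('k, 'x) monoid_scheme \<Rightarrow> ('l, 'y) monoid_scheme \<Rightarrow> ('k + 'l) set" where
  "amalgam_alphabet K L = carrier K <+> carrier L"

definition amalgam_rels ::
    "('k, 'x) monoid_scheme \<Rightarrow> ('l, 'y) monoid_scheme \<Rightarrow> 'c set \<Rightarrow> ('c \<Rightarrow> 'k) \<Rightarrow> ('c \<Rightarrow> 'l) \<Rightarrow>
     (('k + 'l) list \<times> ('k + 'l) list) set" where
  "amalgam_rels K L C i j =
     table_rels K Inl \<union> table_rels L Inr \<union> {([Inl (i c)], [Inr (j c)]) | c. c \<in> C}"

definition amalgamated_product ::
    "('k, 'x) monoid_scheme \<Rightarrow> ('l, 'y) monoid_scheme \<Rightarrow> 'c set \<Rightarrow> ('c \<Rightarrow> 'k) \<Rightarrow> ('c \<Rightarrow> 'l) \<Rightarrow>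
     ('k + 'l) list set monoid" where
  "amalgamated_product K L C i j = presented (amalgam_alphabet K L) (amalgam_rels K L C i j)"

definition amalgam_class ::
    "('k, 'x) monoid_scheme \<Rightarrow> ('l, 'y) monoid_scheme \<Rightarrow> 'c set \<Rightarrow> ('c \<Rightarrow> 'k) \<Rightarrow> ('c \<Rightarrow> 'l) \<Rightarrow>
     ('k + 'l) list \<Rightarrow> ('k + 'l) list set" where
  "amalgam_class K L C i j = word_class (amalgam_alphabet K L) (amalgam_rels K L C i j)"

text \<open>
  \<open>G = P *\<^sub>C Q\<close> for subgroups of \<open>G\<close>: the inclusions of \<open>P\<close> and \<open>Q\<close> induce an isomorphism
  from the amalgamated free product onto \<open>G\<close>.
\<close>

definition is_amalgamated_product ::
    "('a, 'b) monoid_scheme \<Rightarrow> 'a set \<Rightarrow> 'a set \<Rightarrow> 'a set \<Rightarrow> bool" where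
  "is_amalgamated_product G P Q C \<longleftrightarrow>
     subgroup P G \<and> subgroup Q G \<and> subgroup C G \<and> C \<subseteq> P \<and> C \<subseteq> Q \<and>
     (let K = G\<lparr>carrier := P\<rparr>; L = G\<lparr>carrier := Q\<rparr> in
       \<exists>\<psi> \<in> iso (amalgamated_product K L C (\<lambda>c. c) (\<lambda>c. c)) G.
         (\<forall>p\<in>P. \<psi> (amalgam_class K L C (\<lambda>c. c) (\<lambda>c. c) [Inl p]) = p) \<and>
         (\<forall>q\<in>Q. \<psi> (amalgam_class K L C (\<lambda>c. c) (\<lambda>c. c) [Inr q]) = q))"

section \<open>HNN-extensions\<close>

datatype 'k hnn_letter = Base 'k | Stable | StableInv

text \<open>
  \<open>\<langle>K, t | t c t\<^sup>-\<^sup>1 = \<phi> c for c \<in> C\<rangle>\<close> for an isomorphism \<open>\<phi>\<close> from the subgroup \<open>C\<close> of \<open>K\<close> onto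
  another subgroup of \<open>K\<close>.
\<close>

definition hnn_alphabet :: "('k, 'x) monoid_scheme \<Rightarrow> 'k hnn_letter set" where
  "hnn_alphabet K = Base ` carrier K \<union> {Stable, StableInv}"

definition hnn_rels ::
    "('k, 'x) monoid_scheme \<Rightarrow> 'k set \<Rightarrow> ('k \<Rightarrow> 'k) \<Rightarrow>
     ('k hnn_letter list \<times> 'k hnn_letter list) set" where
  "hnn_rels K C \<phi> =
     table_rels K Base \<union> {([Stable, StableInv], []), ([StableInv, Stable], [])} \<union>
     {([Stable, Base c, StableInv], [Base (\<phi> c)]) | c. c \<in> C}"

definition hnn_extension ::
    "('k, 'x) monoid_scheme \<Rightarrow> 'k set \<Rightarrow> ('k \<Rightarrow> 'k) \<Rightarrow> 'k hnn_letter list set monoid" where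
  "hnn_extension K C \<phi> = presented (hnn_alphabet K) (hnn_rels K C \<phi>)"

definition hnn_class ::
    "('k, 'x) monoid_scheme \<Rightarrow> 'k set \<Rightarrow> ('k \<Rightarrow> 'k) \<Rightarrow>
     'k hnn_letter list \<Rightarrow> 'k hnn_letter list set" where
  "hnn_class K C \<phi> = word_class (hnn_alphabet K) (hnn_rels K C \<phi>)"

text \<open>
  \<open>G = P *\<^sub>C\<close> for subgroups of \<open>G\<close>.  The stable letter may be any element of \<open>G\<close>: it is the image
  of \<open>Stable\<close> under \<open>\<psi>\<close>.
\<close>

definition is_hnn_extension :: "('a, 'b) monoid_scheme \<Rightarrow> 'a set \<Rightarrow> 'a set \<Rightarrow> bool" where
  "is_hnn_extension G P C \<longleftrightarrow>
     subgroup P G \<and> subgroup C G \<and> C \<subseteq> P \<and>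
     (let K = G\<lparr>carrier := P\<rparr> in
       \<exists>\<phi> \<in> hom (G\<lparr>carrier := C\<rparr>) K. inj_on \<phi> C \<and>
         (\<exists>\<psi> \<in> iso (hnn_extension K C \<phi>) G. \<forall>p\<in>P. \<psi> (hnn_class K C \<phi> [Base p]) = p))"

section \<open>Splittings\<close>

definition splits_nontrivially_over :: "('a, 'b) monoid_scheme \<Rightarrow> 'a set \<Rightarrow> bool" where
  "splits_nontrivially_over G C \<longleftrightarrow>
     (\<exists>P Q. is_amalgamated_product G P Q C \<and> P \<noteq> C \<and> C \<noteq> Q) \<or>
     (\<exists>P. is_hnn_extension G P C)"

end

theory Submission
  imports Defs
begin

text \<open>
  Since \<open>H\<close> is commensurated, the graph on the left cosets of \<open>H\<close> with edges from \<open>xH\<close> to \<open>xsH\<close>,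
  for \<open>s\<close> in a finite generating set, is locally finite and connected, and the cosets in \<open>A\<close> form
  an infinite set of vertices with infinite complement and finite coboundary.  Among such cuts take
  those whose coboundary is as small as possible, and among these the ones that cross the fewest
  others.  Submodularity of the coboundary shows that they are pairwise nested (Dunwoody; the
  counting argument is due to Kroen).  Hence the translates of one of them and their complements
  are the oriented edges of a tree on which \<open>G\<close> acts with one orbit of edges.  By Bass--Serre theory,
  here in the form of a ping-pong argument on the cuts, \<open>G\<close> splits over the stabilizer of an edge, which
  is commensurable with the vertex stabilizer \<open>H\<close> because each edge of the graph lies in the
  coboundary of only finitely many minimal cuts.
\<close>

section \<open>Optimal cuts of a connected graph\<close>

text \<open>\<open>H_finite\<close> speaks of right cosets \<open>H g\<close>, whereas the vertices
  are left cosets \<open>x H\<close>: left multiplication has to act on the graph, and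
  \<open>A <#> H = A\<close> is what makes \<open>A\<close> a set of vertices. Commensuration
  reconciles the two, because each double coset \<open>H g H\<close> is a finite union of left
  cosets as well as of right cosets. The tree is never built as a graph. Its vertices are the
  classes of an adjacency relation on the oriented edges. As all edges are translates of one edge up
  to orientation, the quotient is a half edge, a segment or a loop: the first two give amalgams, the
  third an HNN-extension. Since the products are defined by presentations, what has to be shown is
  that nonempty words of minimal length in their class are nontrivial in \<open>G\<close>; the
  ping-pong lemmas supply this. An amalgam is nontrivial because both sides of a cut are infinite
  while its coboundary is finite: every optimal cut properly contains a translate of the chosen cut
  or the complement of one.\<close>

definition coboundary :: "('v \<times> 'v) set \<Rightarrow> 'v set \<Rightarrow> ('v \<times> 'v) set" where
  "coboundary E X = {(x, y) \<in> E. x \<in> X \<and> y \<notin> X}"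

definition connected_in :: "('v \<times> 'v) set \<Rightarrow> 'v set \<Rightarrow> bool" where
  "connected_in E X \<longleftrightarrow> (\<forall>x\<in>X. \<forall>y\<in>X. (x, y) \<in> (Restr E X)\<^sup>*)"

text \<open>For subsets of \<open>V\<close> this says that one of the four corners
  \<open>X - Y\<close>, \<open>Y - X\<close>, \<open>X \<inter> Y\<close> and
  \<open>V - (X \<union> Y)\<close> is empty, so it is insensitive to complements.\<close>

definition nested :: "'v set \<Rightarrow> 'v set \<Rightarrow> 'v set \<Rightarrow> bool" where
  "nested V X Y \<longleftrightarrow> X \<subseteq> Y \<or> Y \<subseteq> X \<or> X \<inter> Y = {} \<or> V \<subseteq> X \<union> Y"

text \<open>A path has only finitely many edges. Every set that separates \<open>x\<close> from
  \<open>y\<close> must cross \<open>F\<close>, so finiteness questions about separating cuts reduce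
  to cuts through a single edge.\<close>

lemma rtrancl_finite_subset:
  assumes "(x, y) \<in> r\<^sup>*"
  obtains F where "finite F" "F \<subseteq> r" "(x, y) \<in> F\<^sup>*"
proof -
  have "\<exists>F. finite F \<and> F \<subseteq> r \<and> (x, y) \<in> F\<^sup>*"
    using assms
  proof (induction rule: rtrancl_induct)
    case base
    show ?case by (intro exI[of _ "{}"]) auto
  next
    case (step y z)
    then obtain F where F: "finite F" "F \<subseteq> r" "(x, y) \<in> F\<^sup>*" by blast
    have "(x, y) \<in> (insert (y, z) F)\<^sup>*"
      using F(3) rtrancl_mono[of F "insert (y, z) F"] by blast
    then have "(x, z) \<in> (insert (y, z) F)\<^sup>*"
      by (meson insertI1 rtrancl.rtrancl_into_rtrancl)
    then show ?case
      using F step.hyps by (intro exI[of _ "insert (y, z) F"]) auto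
  qed
  then show ?thesis using that by blast
qed

lemma rtrancl_crosses:
  assumes "(x, y) \<in> r\<^sup>*" "x \<in> X" "y \<notin> X"
  obtains a b where "(a, b) \<in> coboundary r X"
proof -
  have "x \<in> X \<longrightarrow> y \<notin> X \<longrightarrow> coboundary r X \<noteq> {}"
    using assms(1) by (induction rule: rtrancl_induct) (auto simp: coboundary_def)
  then show ?thesis using assms that by auto
qed

lemma coboundary_mono: "r \<subseteq> s \<Longrightarrow> coboundary r X \<subseteq> coboundary s X"
  by (auto simp: coboundary_def)

lemma connected_inD:
  assumes "connected_in E D" "D \<inter> C \<noteq> {}" "D - C \<noteq> {}"
  obtains a b where "(a, b) \<in> coboundary E C" "a \<in> D" "b \<in> D"
proof -
  obtain x y where "x \<in> D" "x \<in> C" "y \<in> D" "y \<notin> C" using assms by blast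
  then have "(x, y) \<in> (Restr E D)\<^sup>*" using assms by (auto simp: connected_in_def)
  then obtain a b where "(a, b) \<in> coboundary (Restr E D) C"
    using \<open>x \<in> C\<close> \<open>y \<notin> C\<close> by (rule rtrancl_crosses)
  then show ?thesis using that by (auto simp: coboundary_def)
qed

lemma nested_sym: "nested V X Y \<longleftrightarrow> nested V Y X"
  by (auto simp: nested_def)

lemma nested_compl: "X \<subseteq> V \<Longrightarrow> Y \<subseteq> V \<Longrightarrow> nested V X (V - Y) \<longleftrightarrow> nested V X Y"
  unfolding nested_def by blast

lemma sym_rtrancl_iff: "sym r \<Longrightarrow> (x, y) \<in> r\<^sup>* \<longleftrightarrow> (y, x) \<in> r\<^sup>*"
  by (meson sym_def sym_rtrancl)

text \<open>
  Thomassen and Woess: delete the edge.  If its ends stay connected by a finite path, then every bond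
  in question uses an edge of that path, and has one edge less in the smaller graph.
\<close>

lemma finite_bonds:
  assumes "E \<subseteq> V \<times> V" "sym E" "\<And>x y. x \<in> V \<Longrightarrow> y \<in> V \<Longrightarrow> (x, y) \<in> E\<^sup>*"
  shows "finite {X. X \<subseteq> V \<and> (a, b) \<in> coboundary E X \<and> connected_in E X \<and> connected_in E (V - X) \<and>
    finite (coboundary E X) \<and> card (coboundary E X) = k}"
  using assms
proof (induction k arbitrary: E a b)
  case 0
  then show ?case by (auto intro: rev_finite_subset[of "{}"])
next
  case (Suc k)
  let ?B = "{X. X \<subseteq> V \<and> (a, b) \<in> coboundary E X \<and> connected_in E X \<and> connected_in E (V - X) \<and>
    finite (coboundary E X) \<and> card (coboundary E X) = Suc k}"
  define E' where "E' = E - {(a, b), (b, a)}"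
  have E': "E' \<subseteq> V \<times> V" "sym E'" "E' \<subseteq> E"
    using Suc.prems by (auto simp: E'_def sym_def)
  \<comment> \<open>The deleted edge joins \<open>X\<close> to its complement, so neither induced
    subgraph loses an edge and both sides stay connected.\<close>
  have restr: "Restr E' X = Restr E X" "Restr E' (V - X) = Restr E (V - X)"
    if "(a, b) \<in> coboundary E X" for X
    using that by (auto simp: E'_def coboundary_def)
  have conn: "connected_in E' X \<longleftrightarrow> connected_in E X" "connected_in E' (V - X) \<longleftrightarrow> connected_in E (V - X)"
    if "(a, b) \<in> coboundary E X" for X
    using restr[OF that] by (simp_all add: connected_in_def)
  have reach: "(x, y) \<in> E'\<^sup>*" if "connected_in E' X" "x \<in> X" "y \<in> X" for X x y
    using that rtrancl_mono[of "Restr E' X" E'] by (auto simp: connected_in_def)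
  show ?case
  proof (cases "(a, b) \<in> E'\<^sup>*")
    case True
    \<comment> \<open>The induction hypothesis wants a connected graph again: a path from
      \<open>a\<close> to \<open>b\<close> replaces the deleted edge.\<close>
    then have "(b, a) \<in> E'\<^sup>*" using E'(2) sym_rtrancl_iff by metis
    then have "E \<subseteq> E'\<^sup>*" using True by (auto simp: E'_def)
    then have "E\<^sup>* \<subseteq> E'\<^sup>*" by (metis rtrancl_idemp rtrancl_mono)
    then have conn': "\<And>x y. x \<in> V \<Longrightarrow> y \<in> V \<Longrightarrow> (x, y) \<in> E'\<^sup>*" using Suc.prems(3) by blast
    obtain F where F: "finite F" "F \<subseteq> E'" "(a, b) \<in> F\<^sup>*"
      using True by (rule rtrancl_finite_subset)
    let ?C = "\<lambda>(c, d). {X. X \<subseteq> V \<and> (c, d) \<in> coboundary E' X \<and> connected_in E' X \<and>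
      connected_in E' (V - X) \<and> finite (coboundary E' X) \<and> card (coboundary E' X) = k}"
    have "?B \<subseteq> (\<Union>e\<in>F. ?C e)"
    proof
      fix X assume X: "X \<in> ?B"
      then have ab: "(a, b) \<in> coboundary E X" by blast
      obtain c d where cd: "(c, d) \<in> coboundary F X"
        using F(3) ab by (auto simp: coboundary_def elim: rtrancl_crosses)
      have "coboundary E' X = coboundary E X - {(a, b)}"
        using ab by (auto simp: coboundary_def E'_def)
      then have "card (coboundary E' X) = k" "finite (coboundary E' X)"
        using X ab by (auto simp: card_Diff_singleton)
      then have "X \<in> ?C (c, d)"
        using X cd conn[OF ab] coboundary_mono[OF F(2), of X] by auto
      moreover have "(c, d) \<in> F" using cd by (auto simp: coboundary_def)
      ultimately show "X \<in> (\<Union>e\<in>F. ?C e)" by blast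
    qed
    moreover have "finite (\<Union>e\<in>F. ?C e)"
      using F(1) Suc.IH[OF E'(1,2) conn'] by (auto split: prod.split)
    ultimately show ?thesis by (rule finite_subset)
  next
    case False
    \<comment> \<open>The ends now lie in different components. Both sides of the bond are still
      connected, so \<open>X\<close> can only be the component of \<open>a\<close>.\<close>
    have "X = {x \<in> V. (a, x) \<in> E'\<^sup>*}" if X: "X \<in> ?B" for X
    proof -
      have ab: "(a, b) \<in> coboundary E X" using X by blast
      then have ab': "a \<in> X" "b \<in> V - X" using Suc.prems(1) by (auto simp: coboundary_def)
      have "(a, x) \<in> E'\<^sup>*" if "x \<in> X" for x
        using reach[of X a x] conn[OF ab] X ab' that by auto
      moreover have "(a, x) \<notin> E'\<^sup>*" if "x \<in> V - X" for x
      proof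
        assume "(a, x) \<in> E'\<^sup>*"
        moreover have "(x, b) \<in> E'\<^sup>*"
          using reach[of "V - X" x b] conn[OF ab] X ab' that by auto
        ultimately show False using False rtrancl_trans[of a x E' b] by blast
      qed
      ultimately show ?thesis using X by blast
    qed
    then have "?B \<subseteq> {{x \<in> V. (a, x) \<in> E'\<^sup>*}}" by blast
    then show ?thesis by (rule finite_subset) simp
  qed
qed

section \<open>Cuts with two infinite sides and minimal coboundary\<close>

locale connected_graph =
  fixes V :: "'v set" and E :: "('v \<times> 'v) set"
  assumes E_sub: "E \<subseteq> V \<times> V"
    and sym_E: "sym E"
    and connected: "x \<in> V \<Longrightarrow> y \<in> V \<Longrightarrow> (x, y) \<in> E\<^sup>*"
begin

definition cut :: "'v set \<Rightarrow> bool" where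
  "cut X \<longleftrightarrow> X \<subseteq> V \<and> infinite X \<and> infinite (V - X) \<and> finite (coboundary E X)"

definition min_size :: nat where
  "min_size = (LEAST n. \<exists>X. cut X \<and> card (coboundary E X) = n)"

definition min_cut :: "'v set \<Rightarrow> bool" where
  "min_cut X \<longleftrightarrow> cut X \<and> card (coboundary E X) = min_size"

definition crossing :: "'v set \<Rightarrow> 'v set set" where
  "crossing X = {Y. min_cut Y \<and> \<not> nested V X Y}"

text \<open>\<open>card\<close> would be 0 on an infinite set; \<open>finite_crossing\<close>
  ensures that for minimal cuts it is a genuine count.\<close>

definition optimal :: "'v set \<Rightarrow> bool" where
  "optimal X \<longleftrightarrow> min_cut X \<and> (\<forall>Y. min_cut Y \<longrightarrow> card (crossing X) \<le> card (crossing Y))"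

lemma min_cut_sub: "min_cut X \<Longrightarrow> X \<subseteq> V"
  by (simp add: min_cut_def cut_def)

lemma min_size_le: "cut X \<Longrightarrow> min_size \<le> card (coboundary E X)"
  unfolding min_size_def by (rule Least_le) blast

lemma min_cut_exists:
  assumes "cut X"
  obtains Y where "min_cut Y"
proof -
  have "\<exists>n Y. cut Y \<and> card (coboundary E Y) = n" using assms by blast
  then have "\<exists>Y. cut Y \<and> card (coboundary E Y) = min_size"
    unfolding min_size_def by (rule LeastI_ex)
  then show ?thesis using that by (auto simp: min_cut_def)
qed

lemma coboundary_compl: "X \<subseteq> V \<Longrightarrow> coboundary E (V - X) = (coboundary E X)\<inverse>"
  using E_sub sym_E by (auto simp: coboundary_def sym_def)

lemma card_coboundary_compl:
  assumes "X \<subseteq> V"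
  shows "card (coboundary E (V - X)) = card (coboundary E X)"
    and "finite (coboundary E (V - X)) \<longleftrightarrow> finite (coboundary E X)"
  using assms by (simp_all add: coboundary_compl)

lemma cut_compl: "cut X \<Longrightarrow> cut (V - X)"
  unfolding cut_def using card_coboundary_compl(2)[of X] by (auto simp: double_diff)

lemma min_cut_compl: "min_cut X \<Longrightarrow> min_cut (V - X)"
  using cut_compl[of X] card_coboundary_compl(1)[of X] by (simp add: min_cut_def cut_def)

lemma coboundary_nonempty:
  assumes "X \<subseteq> V" "X \<noteq> {}" "X \<noteq> V"
  shows "coboundary E X \<noteq> {}"
proof -
  obtain x y where "x \<in> X" "y \<in> V - X" using assms by blast
  then have "(x, y) \<in> E\<^sup>*" "x \<in> X" "y \<notin> X" using assms(1) connected by auto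
  then show ?thesis by (auto elim: rtrancl_crosses)
qed

text \<open>If \<open>X\<close> fell apart, its coboundary would be the disjoint union of those of a
  component and of the rest. One of the two pieces is infinite, hence a cut, and it has fewer
  boundary edges because the other piece, being nonempty, has some.\<close>

lemma min_cut_connected:
  assumes "min_cut X"
  shows "connected_in E X"
  unfolding connected_in_def
proof (intro ballI)
  fix x y assume xy: "x \<in> X" "y \<in> X"
  have X: "X \<subseteq> V" "infinite X" "infinite (V - X)" "finite (coboundary E X)"
    "card (coboundary E X) = min_size"
    using assms by (auto simp: min_cut_def cut_def)
  define Y where "Y = {z \<in> X. (x, z) \<in> (Restr E X)\<^sup>*}"
  have noedge: "u \<in> Y \<longleftrightarrow> w \<in> Y" if "(u, w) \<in> E" "u \<in> X" "w \<in> X" for u w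
  proof -
    have "(u, w) \<in> Restr E X" "(w, u) \<in> Restr E X"
      using that sym_E by (auto simp: sym_def)
    then show ?thesis
      using that by (auto simp: Y_def intro: rtrancl.rtrancl_into_rtrancl)
  qed
  have split: "coboundary E Y \<union> coboundary E (X - Y) = coboundary E X"
    "coboundary E Y \<inter> coboundary E (X - Y) = {}"
    using noedge by (fastforce simp: coboundary_def Y_def)+
  then have fin: "finite (coboundary E Y)" "finite (coboundary E (X - Y))"
    using X(4) by (metis finite_Un)+
  have cards: "card (coboundary E Y) + card (coboundary E (X - Y)) = min_size"
    using split fin X(5) by (metis card_Un_disjoint)
  \<comment> \<open>\<open>Z\<close> is an infinite piece and \<open>Z'\<close> the other one;
    either the component or the rest may play the role of \<open>Z\<close>.\<close>
  have key: False if "infinite Z" "Z \<subseteq> X" "Z' = X - Z" "Z' \<noteq> {}"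
    "finite (coboundary E Z)" "finite (coboundary E Z')"
    "card (coboundary E Z) + card (coboundary E Z') = min_size" for Z Z'
  proof -
    have "infinite (V - Z)"
      using X(3) that(2) by (meson Diff_mono finite_subset order_refl)
    then have "cut Z" using that X(1) by (auto simp: cut_def)
    then have "card (coboundary E Z') = 0" using min_size_le[of Z] that(7) by simp
    then have "coboundary E Z' = {}" using that(6) by simp
    moreover have "Z \<noteq> {}" using that(1) by auto
    then have "Z' \<subseteq> V" "Z' \<noteq> V" using that(2,3) X(1) by auto
    ultimately show False using coboundary_nonempty[of Z'] that by blast
  qed
  have "X - Y = {}"
  proof (rule ccontr)
    assume ne: "X - Y \<noteq> {}"
    have YX: "Y \<subseteq> X" "X - (X - Y) = Y" "Y \<noteq> {}" using xy by (auto simp: Y_def)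
    show False
    proof (cases "infinite Y")
      case True
      then show False using key[of Y "X - Y"] YX ne fin cards by auto
    next
      case False
      then have "infinite (X - Y)" using X(2) by (metis finite_Diff2)
      then show False using key[of "X - Y" Y] YX ne fin cards by auto
    qed
  qed
  then show "(x, y) \<in> (Restr E X)\<^sup>*" using xy by (auto simp: Y_def)
qed

text \<open>Minimal cuts are bonds: the complement of a minimal cut is minimal too, so both sides
  are connected.\<close>

lemma finite_min_cuts_edge: "finite {X. min_cut X \<and> e \<in> coboundary E X}"
proof (cases e)
  case (Pair a b)
  have "{X. min_cut X \<and> e \<in> coboundary E X} \<subseteq>
    {X. X \<subseteq> V \<and> (a, b) \<in> coboundary E X \<and> connected_in E X \<and> connected_in E (V - X) \<and>
    finite (coboundary E X) \<and> card (coboundary E X) = min_size}"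
    using Pair min_cut_connected min_cut_compl by (auto simp: min_cut_def cut_def)
  then show ?thesis
    by (rule finite_subset) (rule finite_bonds[OF E_sub sym_E connected])
qed

text \<open>Let \<open>W\<close> be the finite set of ends of boundary edges of \<open>C\<close>. A
  minimal cut that crosses \<open>C\<close> is connected and meets both sides of \<open>C\<close>,
  so it meets \<open>W\<close>; the same holds for its complement. Hence it separates two points of
  \<open>W\<close> and crosses one of finitely many paths fixed in advance.\<close>

lemma finite_crossing:
  assumes "min_cut C"
  shows "finite (crossing C)"
proof -
  define W where "W = fst ` coboundary E C \<union> snd ` coboundary E C"
  have W: "finite W" "W \<subseteq> V"
    using assms E_sub by (auto simp: W_def min_cut_def cut_def coboundary_def)
  have "\<exists>F. finite F \<and> F \<subseteq> E \<and> (fst p, snd p) \<in> F\<^sup>*" if "p \<in> W \<times> W" for p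
  proof -
    have "(fst p, snd p) \<in> E\<^sup>*" using that W(2) connected by auto
    then show ?thesis by (rule rtrancl_finite_subset) blast
  qed
  then obtain F where F: "\<And>p. p \<in> W \<times> W \<Longrightarrow> finite (F p) \<and> F p \<subseteq> E \<and> (fst p, snd p) \<in> (F p)\<^sup>*"
    by metis
  define FF where "FF = (\<Union>p\<in>W \<times> W. F p)"
  have FF: "finite FF" "FF \<subseteq> E" using F W(1) by (auto simp: FF_def)
  have "crossing C \<subseteq> (\<Union>e\<in>FF. {X. min_cut X \<and> e \<in> coboundary E X})"
  proof
    fix D assume D: "D \<in> crossing C"
    then have D': "min_cut D" "min_cut (V - D)" "D \<subseteq> V" "\<not> nested V C D"
      by (auto simp: crossing_def min_cut_compl min_cut_sub)
    have touch: "W \<inter> D' \<noteq> {}" if "min_cut D'" "\<not> nested V C D'" for D'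
    proof -
      have "D' \<inter> C \<noteq> {}" "D' - C \<noteq> {}" using that by (auto simp: nested_def)
      then obtain a b where "(a, b) \<in> coboundary E C" "a \<in> D'"
        using connected_inD[OF min_cut_connected[OF \<open>min_cut D'\<close>]] by metis
      then show ?thesis by (force simp: W_def)
    qed
    obtain x where x: "x \<in> W" "x \<in> D" using touch D' by blast
    have "\<not> nested V C (V - D)" using D' nested_compl assms min_cut_sub by blast
    then obtain y where y: "y \<in> W" "y \<notin> D" using touch D' by blast
    have "(x, y) \<in> (F (x, y))\<^sup>*" using F[of "(x, y)"] x y by auto
    then obtain a b where "(a, b) \<in> coboundary (F (x, y)) D"
      using x y by (auto elim: rtrancl_crosses)
    then have "(a, b) \<in> FF" "(a, b) \<in> coboundary E D"
      using x y F[of "(x, y)"] by (auto simp: FF_def coboundary_def)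
    then show "D \<in> (\<Union>e\<in>FF. {X. min_cut X \<and> e \<in> coboundary E X})" using D' by blast
  qed
  then show ?thesis
    using FF(1) finite_min_cuts_edge by (meson finite_UN finite_subset)
qed

section \<open>Uncrossing optimal cuts\<close>

lemma crossing_compl: "min_cut X \<Longrightarrow> crossing (V - X) = crossing X"
  using nested_compl[OF min_cut_sub min_cut_sub, of _ X] nested_sym[of V] by (simp add: crossing_def cong: conj_cong)

lemma optimal_compl: "optimal X \<Longrightarrow> optimal (V - X)"
  by (simp add: optimal_def crossing_compl min_cut_compl)

lemma optimal_exists:
  assumes "cut X"
  obtains Y where "optimal Y"
proof -
  obtain Y where Y: "min_cut Y" using min_cut_exists assms by blast
  obtain Z where "min_cut Z" "\<forall>Y. min_cut Y \<longrightarrow> card (crossing Z) \<le> card (crossing Y)"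
    using ex_has_least_nat[of min_cut Y "\<lambda>Y. card (crossing Y)"] Y by auto
  then show ?thesis using that by (auto simp: optimal_def)
qed

text \<open>An edge leaving \<open>C \<inter> D\<close> or \<open>C \<union> D\<close> leaves
  \<open>C\<close> or \<open>D\<close>, and an edge leaving both of the former leaves both of the
  latter; so no edge counts more often on the left.\<close>

lemma submodular:
  assumes "finite (coboundary E C)" "finite (coboundary E D)"
  shows "finite (coboundary E (C \<inter> D))" "finite (coboundary E (C \<union> D))"
    "card (coboundary E (C \<inter> D)) + card (coboundary E (C \<union> D)) \<le>
     card (coboundary E C) + card (coboundary E D)"
proof -
  let ?I = "coboundary E (C \<inter> D)" and ?U = "coboundary E (C \<union> D)"
  let ?C = "coboundary E C" and ?D = "coboundary E D"
  have sub: "?I \<union> ?U \<subseteq> ?C \<union> ?D" "?I \<inter> ?U \<subseteq> ?C \<inter> ?D"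
    by (auto simp: coboundary_def)
  then show fin: "finite ?I" "finite ?U" using assms by (meson finite_UnI finite_subset le_sup_iff)+
  have "card ?I + card ?U = card (?I \<union> ?U) + card (?I \<inter> ?U)" using fin by (rule card_Un_Int)
  also have "\<dots> \<le> card (?C \<union> ?D) + card (?C \<inter> ?D)"
    using sub assms by (intro add_mono card_mono) auto
  also have "\<dots> = card ?C + card ?D" using assms by (rule card_Un_Int[symmetric])
  finally show "card ?I + card ?U \<le> card ?C + card ?D" .
qed

text \<open>Both sets are cuts, so each has at least \<open>min_size\<close> boundary edges, while
  submodularity allows only \<open>2 * min_size\<close> in total; equality holds twice.\<close>

lemma corners_min_cut:
  assumes "min_cut C" "min_cut D" "infinite (C \<inter> D)" "infinite (V - (C \<union> D))"
  shows "min_cut (C \<inter> D)" "min_cut (C \<union> D)"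
proof -
  have CD: "cut C" "cut D" using assms by (auto simp: min_cut_def)
  note sm = submodular[of C D]
  have fin: "finite (coboundary E C)" "finite (coboundary E D)" using CD by (auto simp: cut_def)
  have "V - (C \<union> D) \<subseteq> V - (C \<inter> D)" "C \<inter> D \<subseteq> C \<union> D" by auto
  then have "infinite (V - (C \<inter> D))" "infinite (C \<union> D)"
    using assms(3,4) finite_subset by blast+
  then have c: "cut (C \<inter> D)" "cut (C \<union> D)"
    using sm(1,2)[OF fin] CD assms(3,4) by (auto simp: cut_def)
  then show "min_cut (C \<inter> D)" "min_cut (C \<union> D)"
    using sm(3)[OF fin] min_size_le[OF c(1)] min_size_le[OF c(2)] assms
    by (auto simp: min_cut_def)
qed

text \<open>Here and in \<open>nested_Un\<close> the hypothesis lists the relations of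
  \<open>X\<close> to \<open>C\<close> and \<open>D\<close> that carry over, so that only
  propositional reasoning remains when crossings are counted.\<close>

lemma nested_Int:
  assumes "X \<subseteq> C \<and> X \<subseteq> D \<or> C \<subseteq> X \<or> D \<subseteq> X \<or> C \<inter> X = {} \<or> D \<inter> X = {} \<or> V \<subseteq> C \<union> X \<and> V \<subseteq> D \<union> X"
  shows "nested V (C \<inter> D) X"
  using assms unfolding nested_def by (elim disjE conjE) blast+

lemma nested_Un:
  assumes "X \<subseteq> C \<or> X \<subseteq> D \<or> C \<subseteq> X \<and> D \<subseteq> X \<or> C \<inter> X = {} \<and> D \<inter> X = {} \<or> V \<subseteq> C \<union> X \<or> V \<subseteq> D \<union> X"
  shows "nested V (C \<union> D) X"
  using assms unfolding nested_def by (elim disjE conjE) blast+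

text \<open>
  A minimal cut crosses the two opposite corners together at most as often as it crosses \<open>C\<close>
  and \<open>D\<close>, and \<open>C\<close> itself, which crosses \<open>D\<close>, crosses neither corner.
\<close>

lemma corners_crossing:
  assumes C: "min_cut C" and D: "min_cut D" and cross: "\<not> nested V C D"
    and inf: "infinite (C \<inter> D)" "infinite (V - (C \<union> D))"
  shows "card (crossing (C \<inter> D)) + card (crossing (C \<union> D)) < card (crossing C) + card (crossing D)"
proof -
  let ?I = "crossing (C \<inter> D)" and ?U = "crossing (C \<union> D)"
  note corners = corners_min_cut[OF C D inf]
  note fin = finite_crossing[OF corners(1)] finite_crossing[OF corners(2)]
    finite_crossing[OF C] finite_crossing[OF D]
  have CV: "C \<subseteq> V" "D \<subseteq> V" using C D min_cut_sub by auto
  have "C \<inter> D \<noteq> {}" "\<not> V \<subseteq> C \<union> D" using cross by (auto simp: nested_def)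
  then have "nested V (C \<inter> D) X \<and> nested V (C \<union> D) X"
    if "X \<subseteq> V" "nested V C X" "nested V D X" for X
  proof -
    \<comment> \<open>These combinations of nesting relations would make \<open>C \<inter> D\<close>
      or \<open>V - (C \<union> D)\<close> empty; every other combination satisfies the hypotheses
      of both \<open>nested_Int\<close> and \<open>nested_Un\<close>.\<close>
    have "\<not> (X \<subseteq> C \<and> V \<subseteq> D \<union> X)" "\<not> (X \<subseteq> D \<and> V \<subseteq> C \<union> X)"
      "\<not> (C \<subseteq> X \<and> D \<inter> X = {})" "\<not> (D \<subseteq> X \<and> C \<inter> X = {})"
      using \<open>C \<inter> D \<noteq> {}\<close> \<open>\<not> V \<subseteq> C \<union> D\<close> by blast+
    then show ?thesis
      using that(2,3) nested_Int[of X C D] nested_Un[of X C D] unfolding nested_def[of V C] nested_def[of V D]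
      by argo
  qed
  then have "?I \<union> ?U \<subseteq> crossing C \<union> crossing D"
    using min_cut_sub by (auto simp: crossing_def)
  moreover have "C \<in> crossing D" using C cross by (auto simp: crossing_def nested_sym)
  moreover have "C \<notin> ?I" "C \<notin> ?U" by (auto simp: crossing_def nested_def)
  ultimately have "?I \<union> ?U \<subset> crossing C \<union> crossing D" by blast
  then have 1: "card (?I \<union> ?U) < card (crossing C \<union> crossing D)"
    using fin by (intro psubset_card_mono) auto
  \<comment> \<open>A cut that crosses both corners crosses both \<open>C\<close> and
    \<open>D\<close>; this settles the cuts that are counted twice.\<close>
  have "nested V (C \<inter> D) X \<or> nested V (C \<union> D) X"
    if "X \<subseteq> V" "nested V C X \<or> nested V D X" for X
    using that(2) nested_Int[of X C D] nested_Un[of X C D] unfolding nested_def[of V C] nested_def[of V D]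
    by argo
  then have "?I \<inter> ?U \<subseteq> crossing C \<inter> crossing D"
    using min_cut_sub by (auto simp: crossing_def)
  then have 2: "card (?I \<inter> ?U) \<le> card (crossing C \<inter> crossing D)"
    using fin by (intro card_mono) auto
  show ?thesis
    using 1 2 card_Un_Int[OF fin(1,2)] card_Un_Int[OF fin(3,4)] by simp
qed

text \<open>Since \<open>C\<close>, \<open>D\<close> and their complements are infinite, at least
  one of the two pairs of opposite corners consists of infinite sets, and complementing
  \<open>D\<close> exchanges the pairs. If \<open>C\<close> and \<open>D\<close> crossed, the two
  minimal cuts obtained from that pair would have fewer crossings in total than \<open>C\<close> and
  \<open>D\<close>, against optimality.\<close>

lemma optimal_nested:
  assumes "optimal C" "optimal D"
  shows "nested V C D"
proof (rule ccontr)
  assume cross: "\<not> nested V C D"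
  have C: "min_cut C" and D: "min_cut D" using assms by (auto simp: optimal_def)
  have False if "optimal D'" "\<not> nested V C D'" "infinite (C \<inter> D')" "infinite (V - (C \<union> D'))" for D'
  proof -
    have D': "min_cut D'" using that by (simp add: optimal_def)
    have "card (crossing C) \<le> card (crossing (C \<inter> D'))"
      "card (crossing D') \<le> card (crossing (C \<union> D'))"
      using assms(1) that(1) corners_min_cut[OF C D' that(3,4)] by (auto simp: optimal_def)
    then show False using corners_crossing[OF C D' that(2,3,4)] by linarith
  qed note key = this
  show False
  proof (cases "infinite (C \<inter> D) \<and> infinite (V - (C \<union> D))")
    case True
    then show False using key assms cross by blast
  next
    case False
    have sub: "C \<subseteq> V" "D \<subseteq> V" using C D min_cut_sub by auto
    have inf: "infinite C" "infinite D" "infinite (V - C)" "infinite (V - D)"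
      using C D by (auto simp: min_cut_def cut_def)
    have eqs: "C = C \<inter> D \<union> C \<inter> (V - D)" "D = C \<inter> D \<union> (V - (C \<union> (V - D)))"
      "V - D = (V - (C \<union> D)) \<union> C \<inter> (V - D)" "V - C = (V - (C \<union> D)) \<union> (V - (C \<union> (V - D)))"
      using sub by blast+
    have "infinite (C \<inter> (V - D))" "infinite (V - (C \<union> (V - D)))"
      using False inf eqs by (metis finite_Un)+
    moreover have "\<not> nested V C (V - D)" using cross nested_compl sub by blast
    ultimately show False using key[of "V - D"] optimal_compl assms(2) by blast
  qed
qed

section \<open>Invariance of optimal cuts under automorphisms\<close>

definition automorphism :: "('v \<Rightarrow> 'v) \<Rightarrow> bool" where
  "automorphism f \<longleftrightarrow> bij_betw f V V \<and> (\<forall>x\<in>V. \<forall>y\<in>V. (f x, f y) \<in> E \<longleftrightarrow> (x, y) \<in> E)"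

context
  fixes f assumes f: "automorphism f"
begin

lemma coboundary_image:
  assumes "X \<subseteq> V"
  shows "coboundary E (f ` X) = map_prod f f ` coboundary E X"
proof -
  have bij: "bij_betw f V V" and edge: "\<And>x y. x \<in> V \<Longrightarrow> y \<in> V \<Longrightarrow> (f x, f y) \<in> E \<longleftrightarrow> (x, y) \<in> E"
    using f by (auto simp: automorphism_def)
  have mem: "f x \<in> f ` X \<longleftrightarrow> x \<in> X" if "x \<in> V" for x
    using bij assms that by (auto simp: bij_betw_def dest: inj_onD)
  show ?thesis
  proof (intro equalityI subsetI)
    fix p assume "p \<in> coboundary E (f ` X)"
    then obtain u w where p: "p = (u, w)" "(u, w) \<in> E" "u \<in> f ` X" "w \<notin> f ` X"
      by (auto simp: coboundary_def)
    have "u \<in> V" "w \<in> V" using p E_sub by auto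
    then obtain x y where "x \<in> V" "y \<in> V" "u = f x" "w = f y"
      using bij by (metis bij_betw_def imageE)
    then show "p \<in> map_prod f f ` coboundary E X"
      using p edge mem by (auto simp: coboundary_def intro!: image_eqI[of _ _ "(x, y)"])
  next
    fix p assume "p \<in> map_prod f f ` coboundary E X"
    then obtain x y where "p = (f x, f y)" "(x, y) \<in> E" "x \<in> X" "y \<notin> X"
      by (auto simp: coboundary_def)
    then show "p \<in> coboundary E (f ` X)"
      using edge mem E_sub by (auto simp: coboundary_def)
  qed
qed

lemma min_cut_image:
  assumes "X \<subseteq> V"
  shows "min_cut (f ` X) \<longleftrightarrow> min_cut X"
proof -
  have bij: "inj_on f V" "f ` V = V" using f by (auto simp: automorphism_def bij_betw_def)
  have compl: "V - f ` X = f ` (V - X)"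
    using bij assms by (metis Diff_subset inj_on_image_set_diff order_refl)
  have inj: "inj_on f X" "inj_on f (V - X)"
    using bij(1) assms by (auto intro: inj_on_subset)
  have "coboundary E X \<subseteq> V \<times> V" using E_sub by (auto simp: coboundary_def)
  then have "inj_on (map_prod f f) (coboundary E X)"
    using map_prod_inj_on[OF bij(1) bij(1)] inj_on_subset by blast
  moreover have "f ` X \<subseteq> V" using assms bij by blast
  ultimately show ?thesis
    using assms inj unfolding min_cut_def cut_def compl coboundary_image[OF assms]
    by (auto simp: finite_image_iff card_image)
qed

lemma crossing_image:
  assumes "X \<subseteq> V"
  shows "crossing (f ` X) = (`) f ` crossing X"
proof -
  have bij: "inj_on f V" "f ` V = V" using f by (auto simp: automorphism_def bij_betw_def)
  have "nested V (f ` X) (f ` Y) \<longleftrightarrow> nested V X Y" if "Y \<subseteq> V" for Y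
  proof -
    have "f ` X \<subseteq> f ` Y \<longleftrightarrow> X \<subseteq> Y" "f ` Y \<subseteq> f ` X \<longleftrightarrow> Y \<subseteq> X"
      using inj_on_image_mem_iff[OF bij(1)] assms that by (auto simp: subset_iff image_iff) (metis bij(1) inj_onD subsetD)+
    moreover have "f ` X \<inter> f ` Y = {} \<longleftrightarrow> X \<inter> Y = {}"
      using inj_on_image_Int[OF bij(1) assms that] by (metis image_is_empty)
    moreover have "V \<subseteq> f ` X \<union> f ` Y \<longleftrightarrow> V \<subseteq> X \<union> Y"
      using inj_on_image_eq_iff[OF bij(1), of "X \<union> Y" V] assms that bij(2) by (auto simp: image_Un)
    ultimately show ?thesis by (simp add: nested_def)
  qed note nest = this
  show ?thesis
  proof (intro equalityI subsetI)
    fix Y assume Y: "Y \<in> crossing (f ` X)"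
    then have "Y \<subseteq> f ` V" using min_cut_sub bij by (auto simp: crossing_def)
    then obtain Z where "Z \<subseteq> V" "Y = f ` Z" by (meson subset_imageE)
    then show "Y \<in> (`) f ` crossing X"
      using Y nest min_cut_image by (auto simp: crossing_def)
  next
    fix Y assume "Y \<in> (`) f ` crossing X"
    then show "Y \<in> crossing (f ` X)"
      using nest min_cut_image min_cut_sub by (auto simp: crossing_def)
  qed
qed

lemma optimal_image: "optimal X \<Longrightarrow> optimal (f ` X)"
proof -
  assume X: "optimal X"
  then have XV: "X \<subseteq> V" "min_cut X" by (auto simp: optimal_def min_cut_sub)
  have "card (crossing (f ` X)) \<le> card (crossing X)"
    unfolding crossing_image[OF XV(1)] using finite_crossing[OF XV(2)] by (rule card_image_le)
  then show ?thesis
    using X min_cut_image[OF XV(1)] unfolding optimal_def by (meson order_trans)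
qed

end

end

section \<open>Groups given by presentations\<close>

lemma word_cong_lists: "(u, v) \<in> word_cong X R \<Longrightarrow> u \<in> lists X \<and> v \<in> lists X"
  by (induction rule: word_cong.induct) auto

lemma word_cong_append:
  assumes "(u, v) \<in> word_cong X R" "x \<in> lists X" "y \<in> lists X"
  shows "(x @ u @ y, x @ v @ y) \<in> word_cong X R"
  using assms
proof (induction rule: word_cong.induct)
  case (rel u v x' y')
  then show ?case
    using word_cong.rel[of u v R X "x @ x'" "y' @ y"] by simp
next
  case (refl u)
  then show ?case by (intro word_cong.refl) simp
next
  case (sym u v)
  then show ?case by (blast intro: word_cong.sym)
next
  case (trans u v w)
  then show ?case by (blast intro: word_cong.trans)
qed

lemma word_cong_rel:
  "(u, v) \<in> R \<Longrightarrow> u \<in> lists X \<Longrightarrow> v \<in> lists X \<Longrightarrow> (u, v) \<in> word_cong X R"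
  using word_cong.rel[of u v R X "[]" "[]"] by simp

text \<open>Minimal length in the class takes the place of irreducibility under rewriting: a
  representative exists at once, and every factor that some relation shortens is excluded without
  any confluence argument.\<close>

definition reduced_word :: "'l set \<Rightarrow> ('l list \<times> 'l list) set \<Rightarrow> 'l list \<Rightarrow> bool" where
  "reduced_word X R w \<longleftrightarrow> w \<in> lists X \<and> (\<forall>v. (w, v) \<in> word_cong X R \<longrightarrow> length w \<le> length v)"

lemma reduced_word_factor:
  assumes "reduced_word X R (x @ u @ y)"
  shows "reduced_word X R u"
proof -
  have l: "x \<in> lists X" "u \<in> lists X" "y \<in> lists X" using assms by (auto simp: reduced_word_def)
  have "length u \<le> length v" if "(u, v) \<in> word_cong X R" for v
    using word_cong_append[OF that l(1,3)] assms by (auto simp: reduced_word_def)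
  then show ?thesis using l by (simp add: reduced_word_def)
qed

lemma reduced_word_prefix: "reduced_word X R (u @ y) \<Longrightarrow> reduced_word X R u"
  using reduced_word_factor[of X R "[]" u y] by simp

lemma reduced_word_exists:
  assumes "w \<in> lists X"
  obtains v where "(w, v) \<in> word_cong X R" "reduced_word X R v"
proof -
  have "\<exists>v. (w, v) \<in> word_cong X R" using word_cong.refl[OF assms] by blast
  then obtain v where v: "(w, v) \<in> word_cong X R"
    "\<And>v'. (w, v') \<in> word_cong X R \<Longrightarrow> length v \<le> length v'"
    using ex_has_least_nat[of "\<lambda>v. (w, v) \<in> word_cong X R" _ length] by metis
  then have "reduced_word X R v"
    using word_cong_lists[OF v(1)] word_cong.trans[OF v(1)] by (auto simp: reduced_word_def)
  then show ?thesis using that v(1) by blast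
qed

definition word_val :: "('a, 'b) monoid_scheme \<Rightarrow> ('l \<Rightarrow> 'a) \<Rightarrow> 'l list \<Rightarrow> 'a" where
  "word_val G f w = foldr (\<lambda>l a. f l \<otimes>\<^bsub>G\<^esub> a) w \<one>\<^bsub>G\<^esub>"

lemma word_val_simps [simp]:
  "word_val G f [] = \<one>\<^bsub>G\<^esub>"
  "word_val G f (l # w) = f l \<otimes>\<^bsub>G\<^esub> word_val G f w"
  by (simp_all add: word_val_def)

locale letters = group G for G :: "('a, 'b) monoid_scheme" (structure) +
  fixes X :: "'l set" and f :: "'l \<Rightarrow> 'a"
  assumes f_closed: "l \<in> X \<Longrightarrow> f l \<in> carrier G"
begin

lemma word_val_closed [simp]: "w \<in> lists X \<Longrightarrow> word_val G f w \<in> carrier G"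
  by (induction w) (auto simp: f_closed)

lemma word_val_append:
  "u \<in> lists X \<Longrightarrow> v \<in> lists X \<Longrightarrow> word_val G f (u @ v) = word_val G f u \<otimes> word_val G f v"
  by (induction u) (auto simp: f_closed m_assoc)

lemma word_cong_val:
  assumes "\<And>u v. (u, v) \<in> R \<Longrightarrow> u \<in> lists X \<Longrightarrow> v \<in> lists X \<Longrightarrow> word_val G f u = word_val G f v"
    and "(u, v) \<in> word_cong X R"
  shows "word_val G f u = word_val G f v"
  using assms(2)
proof (induction rule: word_cong.induct)
  case (rel u v x y)
  then show ?case using assms(1)[of u v] by (simp add: word_val_append)
qed auto

lemma generate_word_val:
  assumes "\<And>s. s \<in> S \<Longrightarrow> \<exists>w\<in>lists X. word_val G f w = s"
    and "\<And>s. s \<in> S \<Longrightarrow> \<exists>w\<in>lists X. word_val G f w = inv s"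
    and "g \<in> generate G S"
  shows "\<exists>w\<in>lists X. word_val G f w = g"
  using assms(3)
proof (induction rule: generate.induct)
  case one
  then show ?case by (intro bexI[of _ "[]"]) auto
next
  case (eng h1 h2)
  then obtain u v where "u \<in> lists X" "v \<in> lists X" "word_val G f u = h1" "word_val G f v = h2"
    by blast
  then show ?case by (intro bexI[of _ "u @ v"]) (auto simp: word_val_append)
qed (use assms in auto)

text \<open>\<open>presented X R\<close> is a priori only a monoid, so triviality of the kernel has
  to be turned into injectivity: \<open>inverse\<close> gives every word a left inverse modulo the
  congruence. The kernel is tested on shortest words, which represent all classes.\<close>

theorem presented_iso:
  assumes rel: "\<And>u v. (u, v) \<in> R \<Longrightarrow> u \<in> lists X \<Longrightarrow> v \<in> lists X \<Longrightarrow>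
      word_val G f u = word_val G f v"
    and inverse: "\<And>l. l \<in> X \<Longrightarrow> \<exists>l'\<in>X. ([l', l], []) \<in> word_cong X R"
    and kernel: "\<And>w. reduced_word X R w \<Longrightarrow> word_val G f w = \<one> \<Longrightarrow> w = []"
    and surj: "\<And>g. g \<in> carrier G \<Longrightarrow> \<exists>w\<in>lists X. word_val G f w = g"
  shows "\<exists>\<psi>\<in>iso (presented X R) G. \<forall>w\<in>lists X. \<psi> (word_class X R w) = word_val G f w"
proof -
  let ?val = "word_val G f"
  have val_cong: "?val u = ?val v" if "(u, v) \<in> word_cong X R" for u v
    using word_cong_val[OF _ that] rel by blast
  have ker: "(w, []) \<in> word_cong X R" if w: "w \<in> lists X" "?val w = \<one>" for w
  proof -
    obtain v where v: "(w, v) \<in> word_cong X R" "reduced_word X R v"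
      using reduced_word_exists[OF w(1)] by blast
    then have "v = []" using kernel val_cong[OF v(1)] w(2) by simp
    then show ?thesis using v by simp
  qed
  have inv_word: "\<exists>v'\<in>lists X. (v' @ v, []) \<in> word_cong X R" if "v \<in> lists X" for v
    using that
  proof (induction v)
    case Nil
    show ?case by (intro bexI[of _ "[]"]) (auto intro: word_cong.refl)
  next
    case (Cons l v)
    then obtain v' l' where *: "v' \<in> lists X" "(v' @ v, []) \<in> word_cong X R"
      "l' \<in> X" "([l', l], []) \<in> word_cong X R" using inverse[of l] by auto
    have "(v' @ [l', l] @ v, v' @ [] @ v) \<in> word_cong X R"
      using * Cons.hyps by (intro word_cong_append) auto
    then have "((v' @ [l']) @ l # v, []) \<in> word_cong X R"
      using word_cong.trans[OF _ *(2)] by simp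
    then show ?case using *(1,3) by (intro bexI[of _ "v' @ [l']"]) auto
  qed
  have inj: "(u, v) \<in> word_cong X R" if uv: "u \<in> lists X" "v \<in> lists X" "?val u = ?val v" for u v
  proof -
    obtain v' where v': "v' \<in> lists X" "(v' @ v, []) \<in> word_cong X R" using inv_word uv by blast
    have "?val v' \<otimes> ?val v = \<one>" using val_cong[OF v'(2)] v'(1) uv by (simp add: word_val_append)
    then have "inv (?val v) = ?val v'" using v'(1) uv by (simp add: inv_equality)
    then have "?val u \<otimes> ?val v' = \<one>" using uv by (metis r_inv word_val_closed)
    then have "?val (u @ v') = \<one>" using uv v'(1) by (simp add: word_val_append)
    then have "(u @ v', []) \<in> word_cong X R" using ker uv v' by simp
    \<comment> \<open>\<open>u @ v' @ v\<close> collapses in two ways: its initial part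
      \<open>u @ v'\<close> and its final part \<open>v' @ v\<close> are both congruent to the empty
      word.\<close>
    then have "(u @ v' @ v, v) \<in> word_cong X R"
      using word_cong_append[of "u @ v'" "[]" X R "[]" v] uv by simp
    moreover have "(u @ v' @ v, u) \<in> word_cong X R"
      using word_cong_append[OF v'(2) uv(1), of "[]"] by simp
    ultimately show ?thesis by (blast intro: word_cong.sym word_cong.trans)
  qed
  have cong_iff: "(u, v) \<in> word_cong X R \<longleftrightarrow> u \<in> lists X \<and> v \<in> lists X \<and> ?val u = ?val v" for u v
    using inj val_cong word_cong_lists by blast
  have cls: "word_class X R u = {v \<in> lists X. ?val v = ?val u}" if "u \<in> lists X" for u
    using that cong_iff by (auto simp: word_class_def)
  have car: "carrier (presented X R) = word_class X R ` lists X"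
    by (auto simp: presented_def quotient_def word_class_def)
  \<comment> \<open>All words of a class have the same value, so the choice of representative is
    immaterial.\<close>
  define \<psi> where "\<psi> U = ?val (SOME u. u \<in> U)" for U
  have \<psi>: "\<psi> (word_class X R w) = ?val w" if "w \<in> lists X" for w
  proof -
    have "w \<in> word_class X R w" using that by (simp add: cls)
    then have "(SOME u. u \<in> word_class X R w) \<in> word_class X R w" by (rule someI)
    then show ?thesis using cls[OF that] by (simp add: \<psi>_def)
  qed
  have mult: "word_class X R u \<otimes>\<^bsub>presented X R\<^esub> word_class X R v = word_class X R (u @ v)"
    if "u \<in> lists X" "v \<in> lists X" for u v
  proof -
    have "word_class X R (u' @ v') = word_class X R (u @ v)"
      if "u' \<in> word_class X R u" "v' \<in> word_class X R v" for u' v'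
      using that \<open>u \<in> lists X\<close> \<open>v \<in> lists X\<close> by (simp add: cls word_val_append)
    moreover have "u \<in> word_class X R u" "v \<in> word_class X R v" using that by (simp_all add: cls)
    ultimately have "(\<Union>u'\<in>word_class X R u. \<Union>v'\<in>word_class X R v. word_class X R (u' @ v')) =
      word_class X R (u @ v)"
      by (metis (no_types, lifting) SUP_eq_const empty_iff)
    then show ?thesis by (simp add: presented_def)
  qed
  have "\<psi> \<in> hom (presented X R) G"
    by (rule homI; unfold car; elim imageE; simp add: mult \<psi> word_val_append del: in_lists_conv_set)
  moreover have "inj_on \<psi> (carrier (presented X R))"
    by (rule inj_onI; unfold car; elim imageE; hypsubst; simp only: \<psi>; simp only: cls)
  moreover have "\<psi> ` carrier (presented X R) = carrier G"
  proof -
    have "\<psi> ` carrier (presented X R) = word_val G f ` lists X"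
      unfolding car image_image by (rule image_cong) (simp_all add: \<psi> del: in_lists_conv_set)
    also have "\<dots> = carrier G" using surj word_val_closed by blast
    finally show ?thesis .
  qed
  ultimately have "\<psi> \<in> iso (presented X R) G" by (simp add: iso_def bij_betw_def)
  then show ?thesis using \<psi> by blast
qed

end

lemma table_rels_word_cong:
  assumes "monoid K" "f ` carrier K \<subseteq> X" "table_rels K f \<subseteq> R"
  shows "([f \<one>\<^bsub>K\<^esub>], []) \<in> word_cong X R"
    and "x \<in> carrier K \<Longrightarrow> y \<in> carrier K \<Longrightarrow> ([f x, f y], [f (x \<otimes>\<^bsub>K\<^esub> y)]) \<in> word_cong X R"
proof -
  show "([f \<one>\<^bsub>K\<^esub>], []) \<in> word_cong X R"
    using assms monoid.one_closed[OF assms(1)] by (intro word_cong_rel) (auto simp: table_rels_def)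
  show "([f x, f y], [f (x \<otimes>\<^bsub>K\<^esub> y)]) \<in> word_cong X R" if "x \<in> carrier K" "y \<in> carrier K"
    using assms that monoid.m_closed[OF assms(1) that]
    by (intro word_cong_rel) (auto simp: table_rels_def)
qed

lemma table_rels_inverse:
  assumes "group K" "f ` carrier K \<subseteq> X" "table_rels K f \<subseteq> R" "x \<in> carrier K"
  shows "([f (inv\<^bsub>K\<^esub> x), f x], []) \<in> word_cong X R"
proof -
  interpret K: group K by fact
  show ?thesis
    using table_rels_word_cong[OF K.is_monoid assms(2,3)] assms(4) K.l_inv[OF assms(4)]
      word_cong.trans by (metis K.inv_closed)
qed

section \<open>Amalgams and HNN-extensions recognised by reduced words\<close>

context group
begin

text \<open>A shortest word alternates between the factors, since neighbours from one factor
  multiply. If it has at least 2 letters, none of them is in \<open>C\<close>, since such a letter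
  could be moved to the other factor and then merged with a neighbour. These are the words to which
  \<open>free\<close> applies.\<close>

lemma is_amalgamated_productI:
  assumes P: "subgroup P G" and Q: "subgroup Q G" and C: "subgroup C G"
    and sub: "C \<subseteq> P" "C \<subseteq> Q"
    and gen: "generate G (P \<union> Q) = carrier G"
    and free: "\<And>w. w \<in> lists (P <+> Q) \<Longrightarrow> successively (\<lambda>l m. isl l \<noteq> isl m) w \<Longrightarrow>
      case_sum id id ` set w \<inter> C = {} \<Longrightarrow> length w \<ge> 2 \<Longrightarrow> word_val G (case_sum id id) w \<noteq> \<one>"
  shows "is_amalgamated_product G P Q C"
proof -
  let ?K = "G\<lparr>carrier := P\<rparr>" and ?L = "G\<lparr>carrier := Q\<rparr>"
  let ?X = "amalgam_alphabet ?K ?L" and ?R = "amalgam_rels ?K ?L C (\<lambda>c. c) (\<lambda>c. c)"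
  let ?f = "case_sum id id :: 'a + 'a \<Rightarrow> 'a"
  have X: "?X = P <+> Q" by (simp add: amalgam_alphabet_def)
  interpret PQ: letters G ?X ?f
    using subgroup.subset[OF P] subgroup.subset[OF Q] by unfold_locales (auto simp: X)
  have K: "group ?K" "group ?L" using P Q subgroup_imp_group by auto
  have tabs: "table_rels ?K Inl \<subseteq> ?R" "table_rels ?L Inr \<subseteq> ?R" "Inl ` P \<subseteq> ?X" "Inr ` Q \<subseteq> ?X"
    by (auto simp: amalgam_rels_def X)
  have mon: "monoid ?K" "monoid ?L" using K group.is_monoid by auto
  note tabI = table_rels_word_cong[of ?K Inl ?X ?R, OF mon(1)]
  note tabJ = table_rels_word_cong[of ?L Inr ?X ?R, OF mon(2)]
  have swap: "([Inl c], [Inr c]) \<in> word_cong ?X ?R" if "c \<in> C" for c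
    using that sub by (intro word_cong_rel) (auto simp: amalgam_rels_def X)
  have "\<exists>\<psi>\<in>iso (presented ?X ?R) G. \<forall>w\<in>lists ?X. \<psi> (word_class ?X ?R w) = word_val G ?f w"
  proof (rule PQ.presented_iso)
    fix u v assume "(u, v) \<in> ?R"
    then show "word_val G ?f u = word_val G ?f v"
      using subgroup.mem_carrier[OF P] subgroup.mem_carrier[OF Q] subgroup.mem_carrier[OF C]
      by (auto simp: amalgam_rels_def table_rels_def)
  next
    fix l assume "l \<in> ?X"
    then consider x where "l = Inl x" "x \<in> P" | x where "l = Inr x" "x \<in> Q" by (auto simp: X)
    then show "\<exists>l'\<in>?X. ([l', l], []) \<in> word_cong ?X ?R"
    proof cases
      case 1
      then have "([Inl (inv\<^bsub>?K\<^esub> x), l], []) \<in> word_cong ?X ?R"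
        using table_rels_inverse[OF K(1), of Inl ?X ?R x] tabs by simp
      moreover have "inv\<^bsub>?K\<^esub> x \<in> P" using group.inv_closed[OF K(1), of x] 1 by simp
      ultimately show ?thesis by (auto simp: X)
    next
      case 2
      then have "([Inr (inv\<^bsub>?L\<^esub> x), l], []) \<in> word_cong ?X ?R"
        using table_rels_inverse[OF K(2), of Inr ?X ?R x] tabs by simp
      moreover have "inv\<^bsub>?L\<^esub> x \<in> Q" using group.inv_closed[OF K(2), of x] 2 by simp
      ultimately show ?thesis by (auto simp: X)
    qed
  next
    fix g assume "g \<in> carrier G"
    then have "g \<in> generate G (P \<union> Q)" using gen by simp
    moreover have "\<exists>w\<in>lists ?X. word_val G ?f w = s" if "s \<in> P \<union> Q" for s
      using that
    proof
      assume "s \<in> P"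
      then show ?thesis
        using subgroup.mem_carrier[OF P] by (intro bexI[of _ "[Inl s]"]) (auto simp: X)
    next
      assume "s \<in> Q"
      then show ?thesis
        using subgroup.mem_carrier[OF Q] by (intro bexI[of _ "[Inr s]"]) (auto simp: X)
    qed
    moreover have "inv s \<in> P \<union> Q" if "s \<in> P \<union> Q" for s
      using that subgroup.m_inv_closed[OF P] subgroup.m_inv_closed[OF Q] by blast
    ultimately show "\<exists>w\<in>lists ?X. word_val G ?f w = g"
      using PQ.generate_word_val[of "P \<union> Q" g] by blast
  next
    fix w assume red: "reduced_word ?X ?R w" and val: "word_val G ?f w = \<one>"
    have w: "w \<in> lists ?X" using red by (simp add: reduced_word_def)
    have short: "\<not> reduced_word ?X ?R u" if "(u, v) \<in> word_cong ?X ?R" "length v < length u" for u v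
      using that by (auto simp: reduced_word_def)
    have pair: "isl l \<noteq> isl m \<and> ?f l \<notin> C \<and> ?f m \<notin> C" if lm: "w = x @ [l, m] @ y" for l m x y
    proof -
      have red': "reduced_word ?X ?R [l, m]" using red lm reduced_word_factor by blast
      have lmX: "l \<in> ?X" "m \<in> ?X" using w lm by auto
      have same: "isl l \<noteq> isl m" if lm': "reduced_word ?X ?R [l, m]" "l \<in> ?X" "m \<in> ?X" for l m
      proof
        assume "isl l = isl m"
        then consider x y where "l = Inl x" "m = Inl y" "x \<in> P" "y \<in> P"
          | x y where "l = Inr x" "m = Inr y" "x \<in> Q" "y \<in> Q"
          using lm'(2,3) by (auto simp: X)
        then show False
        proof cases
          case 1
          then show False using short[of "[l, m]" "[Inl (x \<otimes> y)]"] lm'(1) tabI(2)[of x y] tabs by simp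
        next
          case 2
          then show False using short[of "[l, m]" "[Inr (x \<otimes> y)]"] lm'(1) tabJ(2)[of x y] tabs by simp
        qed
      qed
      \<comment> \<open>Moves a letter of \<open>C\<close> to the other factor. The length does not
        change, so the word stays shortest, but two neighbours now lie in one factor.\<close>
      define sw where "sw l = (case l of Inl c \<Rightarrow> Inr c | Inr c \<Rightarrow> Inl c)" for l :: "'a + 'a"
      have sw: "([l], [sw l]) \<in> word_cong ?X ?R" "isl (sw l) \<noteq> isl l" "sw l \<in> ?X" if "?f l \<in> C" for l
        using that swap[of "?f l"] sub by (auto simp: sw_def X intro: word_cong.sym split: sum.splits)
      have trans: "reduced_word ?X ?R v" if "reduced_word ?X ?R u" "(u, v) \<in> word_cong ?X ?R"
        "length u = length v" for u v
        using that word_cong_lists[OF that(2)] word_cong.trans[OF that(2)] by (auto simp: reduced_word_def)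
      have "?f l \<notin> C"
      proof
        assume c: "?f l \<in> C"
        have "([l, m], [sw l, m]) \<in> word_cong ?X ?R"
          using word_cong_append[OF sw(1)[OF c], of "[]" "[m]"] lmX by simp
        then have "reduced_word ?X ?R [sw l, m]" using trans red' by simp
        then show False using same[of "sw l" m] same[of l m] red' lmX sw(2,3)[OF c] by blast
      qed
      moreover have "?f m \<notin> C"
      proof
        assume c: "?f m \<in> C"
        have "([l, m], [l, sw m]) \<in> word_cong ?X ?R"
          using word_cong_append[OF sw(1)[OF c], of "[l]" "[]"] lmX by simp
        then have "reduced_word ?X ?R [l, sw m]" using trans red' by simp
        then show False using same[of l "sw m"] same[of l m] red' lmX sw(2,3)[OF c] by blast
      qed
      ultimately show ?thesis using same red' lmX by blast
    qed
    show "w = []"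
    proof (rule ccontr)
      assume "w \<noteq> []"
      show False
      proof (cases "length w \<ge> 2")
        case True
        have nth: "w = take i w @ [w ! i, w ! Suc i] @ drop (Suc (Suc i)) w" if "Suc i < length w" for i
          using that by (simp add: Cons_nth_drop_Suc)
        have "successively (\<lambda>l m. isl l \<noteq> isl m) w"
          unfolding successively_conv_nth using pair[OF nth] by blast
        moreover have "?f (w ! i) \<notin> C" if i: "i < length w" for i
        proof (cases "Suc i < length w")
          case True
          show ?thesis using pair[OF nth[OF True]] by simp
        next
          case False
          \<comment> \<open>The last letter has no right neighbour; its left neighbour serves
            instead.\<close>
          then obtain j where j: "i = Suc j" using \<open>length w \<ge> 2\<close> by (cases i) auto
          show ?thesis using pair[OF nth[OF i[unfolded j]]] unfolding j by simp
        qed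
        then have "?f ` set w \<inter> C = {}" by (auto simp: in_set_conv_nth)
        ultimately show False using free[of w] w True val X by simp
      next
        case False
        \<comment> \<open>\<open>free\<close> covers length at least 2. A single letter of value
          \<open>\<one>\<close> is the identity of its factor, which the multiplication table
          identifies with the empty word.\<close>
        then obtain l where l: "w = [l]" "l \<in> ?X"
          using \<open>w \<noteq> []\<close> w by (cases w) (auto simp: Suc_le_eq numeral_2_eq_2)
        then have "?f l = \<one>" using val PQ.f_closed[OF l(2)] by simp
        then have "l = Inl \<one> \<or> l = Inr \<one>" by (cases l) auto
        then have "([l], []) \<in> word_cong ?X ?R" using tabI(1) tabJ(1) tabs by auto
        then show False using short[of "[l]" "[]"] red l by simp
      qed
    qed
  qed
  then obtain \<psi> where \<psi>: "\<psi> \<in> iso (presented ?X ?R) G"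
    "\<And>w. w \<in> lists ?X \<Longrightarrow> \<psi> (word_class ?X ?R w) = word_val G ?f w" by blast
  have "\<psi> (word_class ?X ?R [Inl p]) = p" if "p \<in> P" for p
    using \<psi>(2)[of "[Inl p]"] that subgroup.mem_carrier[OF P] by (auto simp: X)
  moreover have "\<psi> (word_class ?X ?R [Inr q]) = q" if "q \<in> Q" for q
    using \<psi>(2)[of "[Inr q]"] that subgroup.mem_carrier[OF Q] by (auto simp: X)
  ultimately show ?thesis
    unfolding is_amalgamated_product_def Let_def amalgamated_product_def amalgam_class_def
    using P Q C sub \<psi>(1) by blast
qed

text \<open>Britton's notion of a reduced word, with \<open>D\<close> the subgroup conjugated to \<open>C\<close> by the stable letter.\<close>

definition britton_reduced :: "'a set \<Rightarrow> 'a set \<Rightarrow> 'a hnn_letter list \<Rightarrow> bool" where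
  "britton_reduced C D w \<longleftrightarrow> (\<forall>x u y. w = x @ u @ y \<longrightarrow>
     (\<forall>p q. u \<noteq> [Base p, Base q]) \<and> u \<noteq> [Stable, StableInv] \<and> u \<noteq> [StableInv, Stable] \<and>
     (\<forall>c\<in>C. u \<noteq> [Stable, Base c, StableInv]) \<and> (\<forall>d\<in>D. u \<noteq> [StableInv, Base d, Stable]))"

definition hnn_val :: "'a \<Rightarrow> 'a hnn_letter \<Rightarrow> 'a" where
  "hnn_val t l = (case l of Base p \<Rightarrow> p | Stable \<Rightarrow> t | StableInv \<Rightarrow> inv t)"

lemma hnn_val_simps [simp]:
  "hnn_val t (Base p) = p" "hnn_val t Stable = t" "hnn_val t StableInv = inv t"
  by (simp_all add: hnn_val_def)

text \<open>Each factor forbidden by \<open>britton_reduced\<close> is congruent to a shorter word,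
  so shortest words are Britton reduced. Without stable letters a shortest word has at most one
  letter, because base letters merge; with them, \<open>free\<close> applies.\<close>

lemma is_hnn_extensionI:
  assumes P: "subgroup P G" and C: "subgroup C G" and sub: "C \<subseteq> P" and t: "t \<in> carrier G"
    and conj: "\<And>c. c \<in> C \<Longrightarrow> t \<otimes> c \<otimes> inv t \<in> P"
    and gen: "generate G (insert t P) = carrier G"
    and free: "\<And>w. w \<in> lists (Base ` P \<union> {Stable, StableInv}) \<Longrightarrow>
      britton_reduced C ((\<lambda>c. t \<otimes> c \<otimes> inv t) ` C) w \<Longrightarrow>
      set w \<inter> {Stable, StableInv} \<noteq> {} \<Longrightarrow> word_val G (hnn_val t) w \<noteq> \<one>"
  shows "is_hnn_extension G P C"
proof -
  define \<phi> where "\<phi> c = t \<otimes> c \<otimes> inv t" for c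
  let ?K = "G\<lparr>carrier := P\<rparr>"
  let ?X = "hnn_alphabet ?K" and ?R = "hnn_rels ?K C \<phi>"
  let ?f = "hnn_val t"
  have X: "?X = Base ` P \<union> {Stable, StableInv}" by (simp add: hnn_alphabet_def)
  note PG = subgroup.mem_carrier[OF P] and CG = subgroup.mem_carrier[OF C]
  interpret PT: letters G ?X ?f
    using PG t by unfold_locales (auto simp: X)
  have K: "group ?K" using P subgroup_imp_group by auto
  then have mon: "monoid ?K" using group.is_monoid by auto
  have tabs: "table_rels ?K Base \<subseteq> ?R" "Base ` carrier ?K \<subseteq> ?X"
    by (auto simp: hnn_rels_def X)
  note tab = table_rels_word_cong[OF mon tabs(2,1), simplified]
  have stab: "([Stable, StableInv], []) \<in> word_cong ?X ?R" "([StableInv, Stable], []) \<in> word_cong ?X ?R"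
    by (rule word_cong_rel; simp add: hnn_rels_def X)+
  have swap: "([Stable, Base c, StableInv], [Base (\<phi> c)]) \<in> word_cong ?X ?R" if "c \<in> C" for c
    using that sub conj by (intro word_cong_rel) (auto simp: hnn_rels_def X \<phi>_def)
  \<comment> \<open>The relation for the inverse conjugation is not a defining one; it follows by
    conjugating \<open>swap\<close> with the stable letter and cancelling.\<close>
  have swap': "([StableInv, Base (\<phi> c), Stable], [Base c]) \<in> word_cong ?X ?R" if c: "c \<in> C" for c
  proof -
    have "([StableInv, Base (\<phi> c), Stable], [StableInv, Stable, Base c, StableInv, Stable]) \<in> word_cong ?X ?R"
      using word_cong_append[OF word_cong.sym[OF swap[OF c]], of "[StableInv]" "[Stable]"] by (simp add: X)
    moreover have "([StableInv, Stable, Base c, StableInv, Stable], [Base c, StableInv, Stable]) \<in> word_cong ?X ?R"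
      using word_cong_append[OF stab(2), of "[]" "[Base c, StableInv, Stable]"] c sub by (auto simp: X)
    moreover have "([Base c, StableInv, Stable], [Base c]) \<in> word_cong ?X ?R"
      using word_cong_append[OF stab(2), of "[Base c]" "[]"] c sub by (auto simp: X)
    ultimately show ?thesis by (blast intro: word_cong.trans)
  qed
  have "\<exists>\<psi>\<in>iso (presented ?X ?R) G. \<forall>w\<in>lists ?X. \<psi> (word_class ?X ?R w) = word_val G ?f w"
  proof (rule PT.presented_iso)
    fix u v assume "(u, v) \<in> ?R"
    then show "word_val G ?f u = word_val G ?f v"
      using PG CG t conj by (auto simp: hnn_rels_def table_rels_def \<phi>_def m_assoc)
  next
    fix l assume "l \<in> ?X"
    then consider x where "l = Base x" "x \<in> P" | "l = Stable" | "l = StableInv" by (auto simp: X)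
    then show "\<exists>l'\<in>?X. ([l', l], []) \<in> word_cong ?X ?R"
    proof cases
      case 1
      then have "([Base (inv\<^bsub>?K\<^esub> x), l], []) \<in> word_cong ?X ?R"
        using table_rels_inverse[OF K tabs(2,1)] by simp
      moreover have "inv\<^bsub>?K\<^esub> x \<in> P" using group.inv_closed[OF K, of x] 1 by simp
      ultimately show ?thesis by (auto simp: X)
    qed (use stab in \<open>auto simp: X\<close>)
  next
    fix g assume "g \<in> carrier G"
    then have g: "g \<in> generate G (insert t P)" using gen by simp
    have base: "\<exists>w\<in>lists ?X. word_val G ?f w = s" if "s \<in> P" for s
      using that PG by (intro bexI[of _ "[Base s]"]) (auto simp: X)
    have "\<exists>w\<in>lists ?X. word_val G ?f w = t"
      using t by (intro bexI[of _ "[Stable]"]) (auto simp: X)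
    moreover have "\<exists>w\<in>lists ?X. word_val G ?f w = inv t"
      using t by (intro bexI[of _ "[StableInv]"]) (auto simp: X)
    moreover have "inv s \<in> P" if "s \<in> P" for s using that subgroup.m_inv_closed[OF P] by blast
    ultimately show "\<exists>w\<in>lists ?X. word_val G ?f w = g"
      using PT.generate_word_val[OF _ _ g] base by blast
  next
    fix w assume red: "reduced_word ?X ?R w" and val: "word_val G ?f w = \<one>"
    have w: "w \<in> lists ?X" using red by (simp add: reduced_word_def)
    have short: "\<not> reduced_word ?X ?R u" if "(u, v) \<in> word_cong ?X ?R" "length v < length u" for u v
      using that by (auto simp: reduced_word_def)
    have merge: "\<not> reduced_word ?X ?R [Base p, Base q]" for p q
    proof
      assume red': "reduced_word ?X ?R [Base p, Base q]"
      then have "p \<in> P" "q \<in> P" by (auto simp: reduced_word_def X)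
      then show False using short[OF tab(2)] red' by simp
    qed
    have "britton_reduced C (\<phi> ` C) w"
      unfolding britton_reduced_def
    proof (intro allI impI)
      fix x u y assume "w = x @ u @ y"
      then have u: "reduced_word ?X ?R u" using red reduced_word_factor by blast
      show "(\<forall>p q. u \<noteq> [Base p, Base q]) \<and> u \<noteq> [Stable, StableInv] \<and> u \<noteq> [StableInv, Stable] \<and>
        (\<forall>c\<in>C. u \<noteq> [Stable, Base c, StableInv]) \<and> (\<forall>d\<in>\<phi> ` C. u \<noteq> [StableInv, Base d, Stable])"
        using u merge short[OF stab(1)] short[OF stab(2)] short[OF swap] short[OF swap'] by auto
    qed
    then have nostab: "set w \<inter> {Stable, StableInv} = {}"
      using free[of w] w val by (auto simp: X \<phi>_def)
    show "w = []"
    proof (cases w)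
      case (Cons l v)
      then obtain p where p: "l = Base p" "p \<in> P" using w nostab by (auto simp: X)
      have "v = []"
      proof (cases v)
        case (Cons m v')
        then obtain q where "m = Base q" using w nostab \<open>w = l # v\<close> by (auto simp: X)
        then show ?thesis
          using merge[of p q] reduced_word_prefix[of ?X ?R "[l, m]" v'] red p Cons \<open>w = l # v\<close> by simp
      qed simp
      then have "p = \<one>" using val p PG Cons by simp
      then show ?thesis using short[OF tab(1)] red Cons p \<open>v = []\<close> by simp
    qed simp
  qed
  then obtain \<psi> where \<psi>: "\<psi> \<in> iso (presented ?X ?R) G"
    "\<And>w. w \<in> lists ?X \<Longrightarrow> \<psi> (word_class ?X ?R w) = word_val G ?f w" by blast
  have "\<psi> (hnn_class ?K C \<phi> [Base p]) = p" if "p \<in> P" for p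
    using \<psi>(2)[of "[Base p]"] that PG by (auto simp: X hnn_class_def)
  moreover have "\<phi> \<in> hom (G\<lparr>carrier := C\<rparr>) ?K"
  proof (rule homI)
    fix c d assume "c \<in> carrier (G\<lparr>carrier := C\<rparr>)" "d \<in> carrier (G\<lparr>carrier := C\<rparr>)"
    then have cd: "c \<in> carrier G" "d \<in> carrier G" using CG by auto
    have "inv t \<otimes> (t \<otimes> (d \<otimes> inv t)) = d \<otimes> inv t" using cd t by (simp add: m_assoc[symmetric])
    then have "\<phi> (c \<otimes> d) = \<phi> c \<otimes> \<phi> d" using cd t by (simp add: \<phi>_def m_assoc)
    then show "\<phi> (c \<otimes>\<^bsub>G\<lparr>carrier := C\<rparr>\<^esub> d) = \<phi> c \<otimes>\<^bsub>?K\<^esub> \<phi> d" by simp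
  qed (use conj in \<open>auto simp: \<phi>_def\<close>)
  moreover have "inj_on \<phi> C"
    using CG t by (auto simp: \<phi>_def intro!: inj_onI)
  ultimately show ?thesis
    unfolding is_hnn_extension_def Let_def hnn_extension_def using P C sub \<psi>(1) by blast
qed

end

section \<open>Group actions with nested translates\<close>

locale action = group G for G :: "('a, 'b) monoid_scheme" (structure) +
  fixes V :: "'v set" and act :: "'a \<Rightarrow> 'v \<Rightarrow> 'v"
  assumes act_closed: "g \<in> carrier G \<Longrightarrow> v \<in> V \<Longrightarrow> act g v \<in> V"
    and act_one: "v \<in> V \<Longrightarrow> act \<one> v = v"
    and act_mult: "g \<in> carrier G \<Longrightarrow> h \<in> carrier G \<Longrightarrow> v \<in> V \<Longrightarrow> act (g \<otimes> h) v = act g (act h v)"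
begin

definition translate :: "'a \<Rightarrow> 'v set \<Rightarrow> 'v set" (infixr "\<cdot>" 75) where
  "g \<cdot> Y = act g ` Y"

lemma translate_closed: "g \<in> carrier G \<Longrightarrow> Y \<subseteq> V \<Longrightarrow> g \<cdot> Y \<subseteq> V"
  using act_closed by (auto simp: translate_def)

lemma translate_one: "Y \<subseteq> V \<Longrightarrow> \<one> \<cdot> Y = Y"
  using act_one by (force simp: translate_def)

lemma translate_mult:
  "g \<in> carrier G \<Longrightarrow> h \<in> carrier G \<Longrightarrow> Y \<subseteq> V \<Longrightarrow> (g \<otimes> h) \<cdot> Y = g \<cdot> h \<cdot> Y"
  unfolding translate_def image_image by (rule image_cong) (auto simp: act_mult)

lemma translate_inv:
  assumes "g \<in> carrier G" "Y \<subseteq> V"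
  shows "inv g \<cdot> g \<cdot> Y = Y" "g \<cdot> inv g \<cdot> Y = Y"
  using assms translate_mult[of "inv g" g Y] translate_mult[of g "inv g" Y] by (simp_all add: translate_one)

lemma translate_mono: "Y \<subseteq> Z \<Longrightarrow> g \<cdot> Y \<subseteq> g \<cdot> Z"
  by (auto simp: translate_def)

lemma translate_subset_iff:
  assumes "g \<in> carrier G" "Y \<subseteq> V" "Z \<subseteq> V"
  shows "g \<cdot> Y \<subseteq> g \<cdot> Z \<longleftrightarrow> Y \<subseteq> Z"
  using assms translate_inv(1) translate_mono[of "g \<cdot> Y" "g \<cdot> Z" "inv g"] translate_mono by metis

lemma translate_eq_iff:
  assumes "g \<in> carrier G" "Y \<subseteq> V" "Z \<subseteq> V"
  shows "g \<cdot> Y = g \<cdot> Z \<longleftrightarrow> Y = Z"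
  using assms translate_inv(1) by metis

lemma translate_psubset_iff:
  assumes "g \<in> carrier G" "Y \<subseteq> V" "Z \<subseteq> V"
  shows "g \<cdot> Y \<subset> g \<cdot> Z \<longleftrightarrow> Y \<subset> Z"
  using translate_subset_iff[OF assms] translate_eq_iff[OF assms] by blast

lemma act_bij:
  assumes "g \<in> carrier G"
  shows "bij_betw (act g) V V"
  using assms act_closed act_mult[of "inv g" g] act_mult[of g "inv g"] act_one
  by (intro bij_betw_byWitness[of _ "act (inv g)"]) auto

lemma translate_compl:
  assumes "g \<in> carrier G" "Y \<subseteq> V"
  shows "g \<cdot> (V - Y) = V - g \<cdot> Y"
  using act_bij[OF assms(1)] assms(2) unfolding translate_def bij_betw_def
  by (metis Diff_subset inj_on_image_set_diff order_refl)

end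

text \<open>
  The translates of a set \<open>X\<close> and their complements are the oriented edges of a tree, on which \<open>G\<close>
  acts with one orbit of edges.
\<close>

locale nested_translates = action +
  fixes X
  assumes X_sub: "X \<subseteq> V" and X_nonempty: "X \<noteq> {}" and X_proper: "X \<noteq> V"
  fixes \<E>
  assumes EE_def: "\<E> = {g \<cdot> X | g. g \<in> carrier G} \<union> {V - g \<cdot> X | g. g \<in> carrier G}"
    and nested: "Y \<in> \<E> \<Longrightarrow> Z \<in> \<E> \<Longrightarrow> nested V Y Z"
    and finite_interval: "Y \<in> \<E> \<Longrightarrow> Z \<in> \<E> \<Longrightarrow> finite {W \<in> \<E>. Y \<subseteq> W \<and> W \<subseteq> Z}"
begin

lemma EE_cases:
  assumes "Y \<in> \<E>"
  obtains g where "g \<in> carrier G" "Y = g \<cdot> X" | g where "g \<in> carrier G" "Y = V - g \<cdot> X"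
  using assms by (auto simp: EE_def)

lemma translate_X: "g \<in> carrier G \<Longrightarrow> g \<cdot> X \<in> \<E>" and compl_translate_X: "g \<in> carrier G \<Longrightarrow> V - g \<cdot> X \<in> \<E>"
  by (auto simp: EE_def)

lemma X_in: "X \<in> \<E>" and compl_X_in: "V - X \<in> \<E>"
  using translate_X[of \<one>] compl_translate_X[of \<one>] X_sub by (auto simp: translate_one)

lemma EE_sub: "Y \<in> \<E> \<Longrightarrow> Y \<subseteq> V"
  using translate_closed X_sub by (auto elim!: EE_cases)

lemma EE_compl: "Y \<in> \<E> \<Longrightarrow> V - Y \<in> \<E>"
proof (elim EE_cases)
  fix g assume "g \<in> carrier G" "Y = V - g \<cdot> X"
  then show ?thesis using translate_closed[of g X] X_sub translate_X[of g] by (simp add: double_diff)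
qed (simp add: compl_translate_X)

lemma EE_translate:
  assumes g: "g \<in> carrier G" and Y: "Y \<in> \<E>"
  shows "g \<cdot> Y \<in> \<E>"
  using Y
proof (rule EE_cases)
  fix h assume "h \<in> carrier G" "Y = h \<cdot> X"
  then show ?thesis using translate_mult[of g h X] X_sub g translate_X[of "g \<otimes> h"] by simp
next
  fix h assume "h \<in> carrier G" "Y = V - h \<cdot> X"
  then show ?thesis
    using translate_mult[of g h X] X_sub g compl_translate_X[of "g \<otimes> h"] translate_closed[of h X]
    by (simp add: translate_compl)
qed

lemma EE_nonempty: "Y \<in> \<E> \<Longrightarrow> Y \<noteq> {}"
proof (elim EE_cases)
  fix g assume "g \<in> carrier G" "Y = V - g \<cdot> X"
  then have "Y = g \<cdot> (V - X)" using X_sub by (simp add: translate_compl)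
  then show ?thesis using X_sub X_proper by (auto simp: translate_def)
qed (use X_nonempty in \<open>auto simp: translate_def\<close>)

text \<open>Two oriented edges are adjacent if they point away from the same vertex of the tree.\<close>

definition adjacent :: "'c set \<Rightarrow> 'c set \<Rightarrow> bool" where
  "adjacent Y Z \<longleftrightarrow> Y \<in> \<E> \<and> Z \<in> \<E> \<and>
     (Y = Z \<or> Y \<subset> V - Z \<and> (\<forall>W\<in>\<E>. Y \<subset> W \<longrightarrow> W \<subseteq> V - Z \<longrightarrow> W = V - Z))"

section \<open>Vertices of the tree as classes of adjacent edges\<close>

lemma adjacentD: "adjacent Y Z \<Longrightarrow> Y = Z \<or> Y \<subset> V - Z"
  and adjacent_in: "adjacent Y Z \<Longrightarrow> Y \<in> \<E>" "adjacent Y Z \<Longrightarrow> Z \<in> \<E>"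
  by (auto simp: adjacent_def)

lemma adjacent_refl: "Y \<in> \<E> \<Longrightarrow> adjacent Y Y"
  by (simp add: adjacent_def)

text \<open>Complementation reverses inclusion and maps the edges between \<open>Y\<close> and
  \<open>V - Z\<close> to those between \<open>Z\<close> and \<open>V - Y\<close>.\<close>

lemma adjacent_sym:
  assumes "adjacent Y Z"
  shows "adjacent Z Y"
proof (cases "Y = Z")
  case False
  have YZ: "Y \<in> \<E>" "Z \<in> \<E>" "Y \<subset> V - Z" "\<And>W. W \<in> \<E> \<Longrightarrow> Y \<subset> W \<Longrightarrow> W \<subseteq> V - Z \<Longrightarrow> W = V - Z"
    using assms False by (auto simp: adjacent_def)
  have sub: "Y \<subseteq> V" "Z \<subseteq> V" using YZ EE_sub by auto
  have "W = V - Y" if W: "W \<in> \<E>" "Z \<subset> W" "W \<subseteq> V - Y" for W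
  proof (rule ccontr)
    assume "W \<noteq> V - Y"
    moreover have WV: "W \<subseteq> V" using W EE_sub by auto
    ultimately have "Y \<subset> V - W" "V - W \<subseteq> V - Z" using W sub by blast+
    then have "V - W = V - Z" using YZ(4) EE_compl W by blast
    then show False using W WV sub by blast
  qed
  moreover have "Z \<subset> V - Y" using YZ(3) sub by blast
  ultimately show ?thesis using YZ by (auto simp: adjacent_def)
qed (use assms in simp)

text \<open>With this \<open>adjacent\<close> is an equivalence relation, and its classes are the
  vertices. Maximality of \<open>Y\<close> and \<open>Z\<close> strictly below \<open>V - X'\<close>
  excludes inclusions between them, and \<open>X'\<close> lies outside their union, so nestedness
  leaves them disjoint. An edge strictly between \<open>Y\<close> and \<open>V - Z\<close> would be
  nested with \<open>X'\<close>, and each of the four ways contradicts nonemptiness or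
  maximality.\<close>

lemma adjacent_trans:
  assumes "adjacent Y X'" "adjacent X' Z"
  shows "adjacent Y Z"
proof (cases "Y = X' \<or> X' = Z \<or> Y = Z")
  case True
  then show ?thesis using assms adjacent_refl adjacent_in by blast
next
  case False
  have E: "Y \<in> \<E>" "X' \<in> \<E>" "Z \<in> \<E>" using assms adjacent_in by auto
  then have sub: "Y \<subseteq> V" "X' \<subseteq> V" "Z \<subseteq> V" and ne: "Y \<noteq> {}" "X' \<noteq> {}" "Z \<noteq> {}"
    using EE_sub EE_nonempty by auto
  have Y: "Y \<subset> V - X'" "\<And>W. W \<in> \<E> \<Longrightarrow> Y \<subset> W \<Longrightarrow> W \<subseteq> V - X' \<Longrightarrow> W = V - X'"
    using assms(1) False by (auto simp: adjacent_def)
  have Z: "Z \<subset> V - X'" "\<And>W. W \<in> \<E> \<Longrightarrow> Z \<subset> W \<Longrightarrow> W \<subseteq> V - X' \<Longrightarrow> W = V - X'"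
    using adjacent_sym[OF assms(2)] False by (auto simp: adjacent_def)
  have "\<not> Y \<subseteq> Z" "\<not> Z \<subseteq> Y" using Y(2)[of Z] Z(2)[of Y] Y(1) Z(1) E False by blast+
  moreover have "\<not> V \<subseteq> Y \<union> Z" using Y(1) Z(1) ne sub by blast
  ultimately have "Y \<inter> Z = {}" using nested[OF E(1,3)] by (auto simp: nested_def)
  moreover have "Y \<noteq> V - Z" using Y(1) Z(1) ne sub by blast
  ultimately have YZ: "Y \<subset> V - Z" using sub by blast
  have "W = V - Z" if W: "W \<in> \<E>" "Y \<subset> W" "W \<subseteq> V - Z" for W
  proof (rule ccontr)
    assume "W \<noteq> V - Z"
    moreover have WV: "W \<subseteq> V" using W EE_sub by auto
    ultimately have ZW: "Z \<subset> V - W" using W sub by blast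
    have X': "\<exists>x. x \<in> X'" "\<exists>x. x \<in> Y" "\<exists>x. x \<in> Z" using ne by auto
    consider "X' \<subseteq> W" | "W \<subseteq> X'" | "X' \<inter> W = {}" | "V \<subseteq> X' \<union> W"
      using nested[OF E(2) W(1)] by (auto simp: nested_def)
    then show False
    proof cases
      case 1
      then have "V - W = V - X'" using Z(2)[of "V - W"] EE_compl[OF W(1)] ZW sub by blast
      then have "V - W = V - X'" "W \<inter> (V - X') = {}" by auto
      then show False using Y(1) W(2) X'(2) by blast
    next
      case 2
      then show False using Y(1) W(2) X' by blast
    next
      case 3
      then have "W = V - X'" using Y(2)[of W] W WV by blast
      then show False using ZW Z(1) X' by blast
    next
      case 4
      then show False using ZW Z(1) X' by blast
    qed
  qed
  then show ?thesis using E YZ by (auto simp: adjacent_def)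
qed

lemma adjacent_translate:
  assumes g: "g \<in> carrier G" and adj: "adjacent Y Z"
  shows "adjacent (g \<cdot> Y) (g \<cdot> Z)"
proof -
  have E: "Y \<in> \<E>" "Z \<in> \<E>" using adj adjacent_in by auto
  then have sub: "Y \<subseteq> V" "Z \<subseteq> V" using EE_sub by auto
  show ?thesis
  proof (cases "Y = Z")
    case True
    then show ?thesis using E EE_translate g adjacent_refl by blast
  next
    case False
    have YZ: "Y \<subset> V - Z" "\<And>W. W \<in> \<E> \<Longrightarrow> Y \<subset> W \<Longrightarrow> W \<subseteq> V - Z \<Longrightarrow> W = V - Z"
      using adj False by (auto simp: adjacent_def)
    have compl: "V - g \<cdot> Z = g \<cdot> (V - Z)" using translate_compl g sub by simp
    have "g \<cdot> Y \<subset> V - g \<cdot> Z" unfolding compl using YZ(1) translate_psubset_iff[OF g sub(1), of "V - Z"] by blast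
    moreover have "W = V - g \<cdot> Z" if W: "W \<in> \<E>" "g \<cdot> Y \<subset> W" "W \<subseteq> V - g \<cdot> Z" for W
    proof -
      let ?W = "inv g \<cdot> W"
      have gW: "g \<cdot> ?W = W" "?W \<subseteq> V" "?W \<in> \<E>"
        using translate_inv(2)[OF g EE_sub[OF W(1)]] EE_sub EE_translate[OF _ W(1)] g by auto
      then have "g \<cdot> Y \<subset> g \<cdot> ?W" "g \<cdot> ?W \<subseteq> g \<cdot> (V - Z)" using W compl by auto
      then have "Y \<subset> ?W" "?W \<subseteq> V - Z"
        using translate_psubset_iff[OF g sub(1) gW(2)] translate_subset_iff[OF g gW(2), of "V - Z"] by auto
      then show ?thesis using YZ(2) gW compl by metis
    qed
    ultimately show ?thesis using E EE_translate g by (auto simp: adjacent_def)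
  qed
qed

text \<open>Intervals are finite, so there is a maximal edge that contains \<open>Y\<close> and lies
  strictly below \<open>V - Z\<close>.\<close>

lemma adjacent_exists:
  assumes "Y \<in> \<E>" "Z \<in> \<E>" "Y \<subset> V - Z"
  obtains W where "adjacent W Z" "Y \<subseteq> W" "W \<subset> V - Z"
proof -
  let ?I = "{W \<in> \<E>. Y \<subseteq> W \<and> W \<subset> V - Z}"
  have "finite {W \<in> \<E>. Y \<subseteq> W \<and> W \<subseteq> V - Z}" using finite_interval assms EE_compl by blast
  then have "finite ?I" by (rule rev_finite_subset) auto
  moreover have "Y \<in> ?I" using assms by auto
  ultimately obtain W where W: "W \<in> ?I" "\<And>W'. W' \<in> ?I \<Longrightarrow> W \<subseteq> W' \<Longrightarrow> W = W'"
    using finite_has_maximal2[of ?I Y] by auto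
  then have "W' = V - Z" if "W' \<in> \<E>" "W \<subset> W'" "W' \<subseteq> V - Z" for W'
    using that by blast
  then have "adjacent W Z" using assms(2) W(1) unfolding adjacent_def by blast
  then show ?thesis using that W by blast
qed

text \<open>Connectedness of the tree as an induction rule. If \<open>Y \<subset> Z\<close>, one
  descends from \<open>Z\<close> to a predecessor \<open>W\<close> containing \<open>Y\<close>,
  which is adjacent to \<open>V - Z\<close>; intervals are finite, so this ends at \<open>Y\<close>.
  Complements reduce the other nestings to inclusion.\<close>

lemma EE_connected:
  assumes M: "Y \<in> M" "Y \<in> \<E>"
    and compl: "\<And>Z. Z \<in> M \<Longrightarrow> Z \<in> \<E> \<Longrightarrow> V - Z \<in> M"
    and adj: "\<And>Z W. Z \<in> M \<Longrightarrow> adjacent Z W \<Longrightarrow> W \<in> M"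
  shows "\<E> \<subseteq> M"
proof -
  have up: "Z \<in> M" if "Z \<in> \<E>" "Y \<subseteq> Z" "Y \<in> M" "Y \<in> \<E>" for Y Z
    using that
  proof (induction "card {W \<in> \<E>. Y \<subseteq> W \<and> W \<subseteq> Z}" arbitrary: Z rule: less_induct)
    case less
    show ?case
    proof (cases "Y = Z")
      case False
      have ZV: "V - (V - Z) = Z" using EE_sub less.prems by (simp add: double_diff)
      then obtain W where W: "adjacent W (V - Z)" "Y \<subseteq> W" "W \<subset> Z"
        using adjacent_exists[of Y "V - Z"] less.prems False EE_compl by auto
      have "card {W' \<in> \<E>. Y \<subseteq> W' \<and> W' \<subseteq> W} < card {W \<in> \<E>. Y \<subseteq> W \<and> W \<subseteq> Z}"
        using W less.prems finite_interval by (intro psubset_card_mono) auto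
      then have "W \<in> M" using less W adjacent_in by blast
      then have "V - Z \<in> M" using adj W by blast
      then show ?thesis using compl[of "V - Z"] EE_compl less.prems ZV by auto
    qed (use less in simp)
  qed
  show ?thesis
  proof
    fix Z assume Z: "Z \<in> \<E>"
    have sub: "Y \<subseteq> V" "Z \<subseteq> V" using Z M EE_sub by auto
    have Zc: "Z \<in> M" if "V - Z \<in> M"
      using compl[OF that] Z EE_compl sub by (simp add: double_diff)
    consider "Y \<subseteq> Z" | "Z \<subseteq> Y" | "Y \<inter> Z = {}" | "V \<subseteq> Y \<union> Z"
      using nested[OF M(2) Z] by (auto simp: nested_def)
    then show "Z \<in> M"
    proof cases
      case 1
      then show ?thesis using up Z M by blast
    next
      case 2
      then have "V - Z \<in> M" using up[of "V - Z" "V - Y"] Z M EE_compl compl by blast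
      then show ?thesis by (rule Zc)
    next
      case 3
      then have "V - Z \<in> M" using up[of "V - Z" Y] Z M EE_compl sub by blast
      then show ?thesis by (rule Zc)
    next
      case 4
      then show ?thesis using up[of Z "V - Y"] Z M EE_compl compl by blast
    qed
  qed
qed

section \<open>Stabilizers of oriented edges and of vertices\<close>

definition edge_stabilizer :: "'a set" where
  "edge_stabilizer = {g \<in> carrier G. g \<cdot> X = X}"

text \<open>Stabilizer of the adjacency class of \<open>Y\<close>, that is, of the vertex from which
  \<open>Y\<close> points away; \<open>V - Y\<close> gives the other end of the edge.\<close>

definition vertex_stabilizer :: "'c set \<Rightarrow> 'a set" where
  "vertex_stabilizer Y = {g \<in> carrier G. adjacent (g \<cdot> Y) Y}"

lemma subgroup_edge_stabilizer: "subgroup edge_stabilizer G"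
proof (rule subgroupI)
  show "edge_stabilizer \<noteq> {}" using X_sub translate_one by (auto simp: edge_stabilizer_def)
  fix g assume g: "g \<in> edge_stabilizer"
  then show "inv g \<in> edge_stabilizer"
    using translate_inv(1)[OF _ X_sub, of g] by (simp add: edge_stabilizer_def)
  fix h assume "h \<in> edge_stabilizer"
  then show "g \<otimes> h \<in> edge_stabilizer"
    using g X_sub translate_mult[of g h X] by (simp add: edge_stabilizer_def)
qed (auto simp: edge_stabilizer_def)

lemma subgroup_vertex_stabilizer:
  assumes Y: "Y \<in> \<E>"
  shows "subgroup (vertex_stabilizer Y) G"
proof (rule subgroupI)
  show "vertex_stabilizer Y \<noteq> {}"
    using Y EE_sub translate_one[of Y] adjacent_refl[OF Y] by (auto simp: vertex_stabilizer_def)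
  fix g assume g: "g \<in> vertex_stabilizer Y"
  have "adjacent (inv g \<cdot> g \<cdot> Y) (inv g \<cdot> Y)"
    using g adjacent_translate[of "inv g"] by (simp add: vertex_stabilizer_def)
  then have "adjacent (inv g \<cdot> Y) Y"
    using g Y EE_sub translate_inv(1)[of g Y] by (simp add: vertex_stabilizer_def adjacent_sym)
  then show "inv g \<in> vertex_stabilizer Y"
    using g by (simp add: vertex_stabilizer_def)
  fix h assume h: "h \<in> vertex_stabilizer Y"
  then have "adjacent (g \<cdot> h \<cdot> Y) (g \<cdot> Y)"
    using g adjacent_translate[of g] by (simp add: vertex_stabilizer_def)
  then have "adjacent (g \<cdot> h \<cdot> Y) Y" using g adjacent_trans by (metis (no_types, lifting) mem_Collect_eq vertex_stabilizer_def)
  then show "g \<otimes> h \<in> vertex_stabilizer Y"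
    using g h Y EE_sub translate_mult[of g h Y] by (simp add: vertex_stabilizer_def)
qed (auto simp: vertex_stabilizer_def)

lemma edge_stabilizer_iff: "g \<in> carrier G \<Longrightarrow> h \<in> carrier G \<Longrightarrow> g \<cdot> X = h \<cdot> X \<longleftrightarrow> inv g \<otimes> h \<in> edge_stabilizer"
  using translate_mult[of "inv g" h X] translate_inv[of g "X"] translate_inv[of g "h \<cdot> X"]
    translate_closed[of h X] X_sub
  by (auto simp: edge_stabilizer_def)

lemma vertex_stabilizer_iff:
  assumes "g \<in> carrier G" "h \<in> carrier G" "Y \<in> \<E>"
  shows "adjacent (g \<cdot> Y) (h \<cdot> Y) \<longleftrightarrow> inv g \<otimes> h \<in> vertex_stabilizer Y"
proof -
  have Y: "Y \<subseteq> V" "h \<cdot> Y \<subseteq> V" using assms EE_sub translate_closed by auto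
  have eq: "(inv g \<otimes> h) \<cdot> Y = inv g \<cdot> h \<cdot> Y" using assms Y translate_mult by simp
  show ?thesis
  proof
    assume "adjacent (g \<cdot> Y) (h \<cdot> Y)"
    then have "adjacent (inv g \<cdot> g \<cdot> Y) (inv g \<cdot> h \<cdot> Y)" using adjacent_translate assms by simp
    then have "adjacent ((inv g \<otimes> h) \<cdot> Y) Y"
      using translate_inv(1)[OF assms(1) Y(1)] eq adjacent_sym by simp
    then show "inv g \<otimes> h \<in> vertex_stabilizer Y" using assms by (simp add: vertex_stabilizer_def)
  next
    assume "inv g \<otimes> h \<in> vertex_stabilizer Y"
    then have "adjacent (inv g \<cdot> h \<cdot> Y) Y" using eq by (simp add: vertex_stabilizer_def)
    then have "adjacent (g \<cdot> inv g \<cdot> h \<cdot> Y) (g \<cdot> Y)" using adjacent_translate assms by simp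
    then show "adjacent (g \<cdot> Y) (h \<cdot> Y)"
      using translate_inv(2)[OF assms(1) Y(2)] adjacent_sym by simp
  qed
qed

lemma edge_stabilizer_sub: "edge_stabilizer \<subseteq> vertex_stabilizer X" "edge_stabilizer \<subseteq> vertex_stabilizer (V - X)"
  using X_in compl_X_in adjacent_refl X_sub
  by (auto simp: edge_stabilizer_def vertex_stabilizer_def translate_compl)

lemma vertex_stabilizer_moves:
  assumes "Y \<in> \<E>" "p \<in> vertex_stabilizer Y" "p \<cdot> Y \<noteq> Y"
  shows "p \<cdot> Y \<subset> V - Y"
  using assms adjacentD by (auto simp: vertex_stabilizer_def)

text \<open>Elements of \<open>P\<close> outside the edge stabilizer move \<open>X\<close> into its
  complement, those of \<open>Q\<close> move the complement into \<open>X\<close>, so an alternating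
  word keeps pushing one set. The inclusion for \<open>Q\<close> is not strict, because with an
  inversion \<open>Q\<close> interchanges the two sides. When the first and last letter belong to
  different factors, the contradiction is a set strictly inside itself; the strictness comes from a
  letter of \<open>P\<close>, which an alternating word of length at least 2 contains.\<close>

lemma amalgam_ping_pong:
  assumes P: "P \<subseteq> carrier G" "\<And>p. p \<in> P \<Longrightarrow> p \<notin> edge_stabilizer \<Longrightarrow> p \<cdot> X \<subset> V - X"
    and Q: "Q \<subseteq> carrier G" "\<And>q. q \<in> Q \<Longrightarrow> q \<notin> edge_stabilizer \<Longrightarrow> q \<cdot> (V - X) \<subseteq> X"
    and w: "w \<in> lists (P <+> Q)" "successively (\<lambda>l m. isl l \<noteq> isl m) w"
      "case_sum id id ` set w \<inter> edge_stabilizer = {}" "length w \<ge> 2"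
  shows "word_val G (case_sum id id) w \<noteq> \<one>"
proof
  let ?val = "word_val G (case_sum id id :: 'a + 'a \<Rightarrow> 'a)"
  interpret PQ: letters G "P <+> Q" "case_sum id id"
    using P(1) Q(1) by unfold_locales auto
  \<comment> \<open>The set on which the last letter of \<open>w\<close> is known to act.\<close>
  define Z where "Z = (if isl (last w) then X else V - X)"
  have ZV: "Z \<subseteq> V" using X_sub by (auto simp: Z_def)
  have claim: "u \<noteq> [] \<Longrightarrow> u \<in> lists (P <+> Q) \<Longrightarrow> successively (\<lambda>l m. isl l \<noteq> isl m) u \<Longrightarrow>
    case_sum id id ` set u \<inter> edge_stabilizer = {} \<Longrightarrow> isl (last u) = isl (last w) \<Longrightarrow>
    (if isl (hd u) then ?val u \<cdot> Z \<subset> V - X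
     else ?val u \<cdot> Z \<subseteq> X \<and> (length u \<ge> 2 \<longrightarrow> ?val u \<cdot> Z \<subset> X))" for u
  proof (induction u)
    case (Cons l u)
    have l: "l \<in> P <+> Q" "case_sum id id l \<notin> edge_stabilizer" using Cons.prems by auto
    show ?case
    proof (cases "u = []")
      case True
      show ?thesis
      proof (cases l)
        case (Inl p)
        then have "p \<in> carrier G" "p \<cdot> X \<subset> V - X" using l P by auto
        then show ?thesis using True Inl Cons.prems(5) by (simp add: Z_def)
      next
        case (Inr q)
        then have "q \<in> carrier G" "q \<cdot> (V - X) \<subseteq> X" using l Q by auto
        then show ?thesis using True Inr Cons.prems(5) by (simp add: Z_def)
      qed
    next
      case False
      then have succ: "isl l \<noteq> isl (hd u)" "successively (\<lambda>l m. isl l \<noteq> isl m) u"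
        using Cons.prems(3) by (auto simp: successively_Cons)
      have u: "u \<in> lists (P <+> Q)" using Cons.prems(2) by simp
      then have val: "?val u \<in> carrier G" by simp
      have valV: "?val u \<cdot> Z \<subseteq> V" using val ZV translate_closed by blast
      have IH: "if isl (hd u) then ?val u \<cdot> Z \<subset> V - X
        else ?val u \<cdot> Z \<subseteq> X \<and> (length u \<ge> 2 \<longrightarrow> ?val u \<cdot> Z \<subset> X)"
        using Cons.IH[OF False u succ(2)] Cons.prems(4,5) False by auto
      show ?thesis
      proof (cases l)
        case (Inl p)
        then have p: "p \<in> carrier G" "p \<cdot> X \<subset> V - X" using l P by auto
        have "?val u \<cdot> Z \<subseteq> X" using IH succ Inl by simp
        then have "p \<cdot> ?val u \<cdot> Z \<subseteq> p \<cdot> X" by (rule translate_mono)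
        then show ?thesis using p Inl translate_mult[OF p(1) val ZV] by auto
      next
        case (Inr q)
        then have q: "q \<in> carrier G" "q \<cdot> (V - X) \<subseteq> X" using l Q by auto
        have "?val u \<cdot> Z \<subset> V - X" using IH succ Inr by simp
        then have "q \<cdot> ?val u \<cdot> Z \<subset> q \<cdot> (V - X)" using translate_psubset_iff q(1) valV by simp
        then show ?thesis using q Inr translate_mult[OF q(1) val ZV] by auto
      qed
    qed
  qed simp
  assume val: "?val w = \<one>"
  have "w \<noteq> []" using w(4) by auto
  then have "if isl (hd w) then Z \<subset> V - X else Z \<subset> X"
    using claim[OF _ w(1-3) HOL.refl] w(4) unfolding val translate_one[OF ZV] by simp
  then show False using X_sub X_nonempty X_proper by (auto simp: Z_def split: if_splits)
qed

lemma is_amalgamated_product_stabilizers: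
  assumes Q: "subgroup Q G" "edge_stabilizer \<subseteq> Q"
    and pong: "\<And>q. q \<in> Q \<Longrightarrow> q \<notin> edge_stabilizer \<Longrightarrow> q \<cdot> (V - X) \<subseteq> X"
    and gen: "generate G (vertex_stabilizer X \<union> Q) = carrier G"
  shows "is_amalgamated_product G (vertex_stabilizer X) Q edge_stabilizer"
proof (rule is_amalgamated_productI)
  have P: "vertex_stabilizer X \<subseteq> carrier G" by (auto simp: vertex_stabilizer_def)
  have "p \<cdot> X \<subset> V - X" if "p \<in> vertex_stabilizer X" "p \<notin> edge_stabilizer" for p
    using vertex_stabilizer_moves[OF X_in that(1)] that by (auto simp: vertex_stabilizer_def edge_stabilizer_def)
  note * = amalgam_ping_pong[OF P this subgroup.subset[OF Q(1)] pong]
  show "word_val G (case_sum id id) w \<noteq> \<one>"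
    if "w \<in> lists (vertex_stabilizer X <+> Q)" "successively (\<lambda>l m. isl l \<noteq> isl m) w"
      "case_sum id id ` set w \<inter> edge_stabilizer = {}" "2 \<le> length w" for w
    using * that by blast
qed (use assms subgroup_edge_stabilizer subgroup_vertex_stabilizer X_in edge_stabilizer_sub in auto)

text \<open>The edges \<open>h \<cdot> X\<close> with \<open>h\<close> in \<open>N\<close> and their
  complements are closed under complement and adjacency, hence are all edges by
  \<open>EE_connected\<close>. So every \<open>g\<close> agrees with some \<open>h\<close> in
  \<open>N\<close> up to an element that fixes or inverts \<open>X\<close>, and \<open>N\<close>
  contains both kinds.\<close>

lemma EE_generated:
  assumes N: "subgroup N G" "edge_stabilizer \<subseteq> N"
    and inversion: "\<And>g. g \<in> carrier G \<Longrightarrow> g \<cdot> X = V - X \<Longrightarrow> g \<in> N"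
    and adj: "\<And>g Y. g \<in> N \<Longrightarrow> adjacent (g \<cdot> X) Y \<Longrightarrow> \<exists>h\<in>N. Y = h \<cdot> X \<or> Y = V - h \<cdot> X"
    and adj': "\<And>g Y. g \<in> N \<Longrightarrow> adjacent (V - g \<cdot> X) Y \<Longrightarrow> \<exists>h\<in>N. Y = h \<cdot> X \<or> Y = V - h \<cdot> X"
  shows "N = carrier G"
proof
  let ?M = "{Y. \<exists>h\<in>N. Y = h \<cdot> X \<or> Y = V - h \<cdot> X}"
  note NG = subgroup.mem_carrier[OF N(1)]
  have one: "\<one> \<in> N" using N(1) by (rule subgroup.one_closed)
  have "\<E> \<subseteq> ?M"
  proof (rule EE_connected[of X])
    show "X \<in> ?M" using one translate_one[OF X_sub] by (auto intro!: bexI[of _ \<one>])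
    show "V - Z \<in> ?M" if "Z \<in> ?M" for Z
      using that NG translate_closed X_sub by (auto simp: double_diff)
    show "W \<in> ?M" if "Z \<in> ?M" "adjacent Z W" for Z W
      using that adj adj' by blast
  qed (rule X_in)
  show "carrier G \<subseteq> N"
  proof
    fix g assume g: "g \<in> carrier G"
    then obtain h where h: "h \<in> N" "g \<cdot> X = h \<cdot> X \<or> g \<cdot> X = V - h \<cdot> X"
      using \<open>\<E> \<subseteq> ?M\<close> translate_X by blast
    note hG = NG[OF h(1)]
    have "inv h \<otimes> g \<in> N" using h(2)
    proof
      assume "g \<cdot> X = h \<cdot> X"
      then show ?thesis using edge_stabilizer_iff[OF hG g] N(2) by auto
    next
      assume "g \<cdot> X = V - h \<cdot> X"
      then have "g \<cdot> X = h \<cdot> (V - X)" using hG X_sub translate_compl by simp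
      then have "(inv h \<otimes> g) \<cdot> X = V - X"
        using hG g X_sub by (simp add: translate_mult translate_inv)
      then show ?thesis using inversion hG g by simp
    qed
    then have "h \<otimes> (inv h \<otimes> g) \<in> N" using subgroup.m_closed[OF N(1) h(1)] by blast
    then show "g \<in> N" using hG g by (simp add: m_assoc[symmetric])
  qed
qed (rule subgroup.subset[OF N(1)])

lemma subgroup_divide:
  assumes "subgroup N G" "g \<in> N" "h \<in> carrier G" "inv g \<otimes> h \<in> N"
  shows "h \<in> N"
proof -
  have "g \<otimes> (inv g \<otimes> h) \<in> N" using subgroup.m_closed[OF assms(1,2,4)] .
  then show ?thesis using assms subgroup.mem_carrier[OF assms(1,2)] by (simp add: m_assoc[symmetric])
qed

end

section \<open>The three possible quotients of the tree: half edge, segment, loop\<close>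

context nested_translates
begin

lemma subgroup_generate_sub:
  assumes "S \<subseteq> carrier G"
  shows "subgroup (generate G S) G" "S \<subseteq> generate G S"
  using generate_is_subgroup[OF assms] by (auto intro: generate.incl)

text \<open>Supplies a second edge at the vertex of \<open>Z\<close>; this is why a vertex
  stabilizer is larger than the edge stabilizer.\<close>

lemma edge_inside_translate:
  assumes "\<exists>Y\<in>\<E>. Y \<subset> V - Z" "Z \<in> \<E>"
  obtains W where "adjacent W Z" "W \<noteq> Z"
proof -
  obtain Y where "Y \<in> \<E>" "Y \<subset> V - Z" using assms by blast
  then obtain W where W: "adjacent W Z" "W \<subset> V - Z" using adjacent_exists assms(2) by metis
  then have "W \<noteq> Z" using EE_nonempty[OF assms(2)] by blast
  then show ?thesis using that W by blast
qed

text \<open>With an inversion \<open>s\<close> every oriented edge is a translate of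
  \<open>X\<close>, so there is one orbit of vertices. The second factor stabilizes the unoriented
  edge, that is, its midpoint after subdivision.\<close>

lemma splitting_inversion:
  assumes s: "s \<in> carrier G" "s \<cdot> X = V - X" and inside: "\<exists>Y\<in>\<E>. Y \<subset> V - X"
  shows "\<exists>P Q. is_amalgamated_product G P Q edge_stabilizer \<and> P \<noteq> edge_stabilizer \<and> edge_stabilizer \<noteq> Q"
proof -
  let ?Q = "{g \<in> carrier G. g \<cdot> X = X \<or> g \<cdot> X = V - X}" and ?P = "vertex_stabilizer X"
  have compl: "g \<cdot> (V - X) = V - g \<cdot> X" if "g \<in> carrier G" for g
    using translate_compl that X_sub by blast
  have dd: "V - (V - X) = X" using X_sub by blast
  have Q: "subgroup ?Q G"
  proof (rule subgroupI)
    show "?Q \<noteq> {}" using s by auto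
    fix g assume g: "g \<in> ?Q"
    have "inv g \<cdot> X = X \<or> inv g \<cdot> (V - X) = X"
      using g translate_inv(1)[OF _ X_sub, of g] by auto
    then show "inv g \<in> ?Q"
      using g compl[of "inv g"] translate_closed[of "inv g" X] X_sub by auto
    fix h assume "h \<in> ?Q"
    then show "g \<otimes> h \<in> ?Q"
      using g X_sub translate_mult[of g h X] compl dd by auto
  qed auto
  have KQ: "edge_stabilizer \<subseteq> ?Q" by (auto simp: edge_stabilizer_def)
  have sQ: "s \<in> ?Q" "s \<notin> edge_stabilizer"
    using s X_nonempty X_sub by (auto simp: edge_stabilizer_def)
  have pong: "q \<cdot> (V - X) \<subseteq> X" if "q \<in> ?Q" "q \<notin> edge_stabilizer" for q
    using that compl[of q] dd by (auto simp: edge_stabilizer_def)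
  have PQ: "?P \<union> ?Q \<subseteq> carrier G" by (auto simp: vertex_stabilizer_def)
  let ?N = "generate G (?P \<union> ?Q)"
  note N = subgroup_generate_sub[OF PQ]
  note NG = subgroup.mem_carrier[OF N(1)]
  have flip: "V - g \<cdot> X = (g \<otimes> s) \<cdot> X" if "g \<in> carrier G" for g
    using that s compl translate_mult[OF that s(1) X_sub] by simp
  have step: "\<exists>h\<in>?N. Y = h \<cdot> X \<or> Y = V - h \<cdot> X" if g: "g \<in> ?N" "adjacent (g \<cdot> X) Y" for g Y
  proof -
    obtain h where h: "h \<in> carrier G" "Y = h \<cdot> X"
      using adjacent_in(2)[OF g(2)] flip s(1) by (metis EE_cases m_closed)
    then have "inv g \<otimes> h \<in> ?P" using g NG vertex_stabilizer_iff X_in by blast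
    then have "h \<in> ?N" using subgroup_divide[OF N(1) g(1) h(1)] N(2) by blast
    then show ?thesis using h by blast
  qed
  have "?N = carrier G"
  proof (rule EE_generated[OF N(1)])
    show "edge_stabilizer \<subseteq> ?N" using KQ N(2) by blast
    show "g \<in> ?N" if "g \<in> carrier G" "g \<cdot> X = V - X" for g using that N(2) by blast
    show "\<exists>h\<in>?N. Y = h \<cdot> X \<or> Y = V - h \<cdot> X" if "g \<in> ?N" "adjacent (V - g \<cdot> X) Y" for g Y
      using step[of "g \<otimes> s" Y] that flip NG subgroup.m_closed[OF N(1) that(1)] N(2) sQ(1) by auto
  qed (rule step)
  then have "is_amalgamated_product G ?P ?Q edge_stabilizer"
    using is_amalgamated_product_stabilizers[OF Q KQ pong] by blast
  moreover have "?P \<noteq> edge_stabilizer"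
  proof -
    obtain W where W: "adjacent W X" "W \<noteq> X" using edge_inside_translate inside X_in by metis
    obtain h where h: "h \<in> carrier G" "W = h \<cdot> X"
      using adjacent_in(1)[OF W(1)] flip s(1) by (metis EE_cases m_closed)
    then have "h \<in> ?P" "h \<notin> edge_stabilizer" using W by (auto simp: vertex_stabilizer_def edge_stabilizer_def)
    then show ?thesis by blast
  qed
  ultimately show ?thesis using sQ by blast
qed

text \<open>\<open>two\<close> says that the ends of the edge \<open>X\<close> lie in different
  orbits, so the edges at the vertex of \<open>X\<close> are translates of \<open>X\<close>, and
  those at the other end are translates of \<open>V - X\<close>. The factors are the stabilizers of
  the two ends, and \<open>inside\<close> provides a second edge at each end.\<close>

lemma splitting_two_vertices:
  assumes no_inversion: "\<And>g. g \<in> carrier G \<Longrightarrow> g \<cdot> X \<noteq> V - X"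
    and two: "\<And>g. g \<in> carrier G \<Longrightarrow> \<not> adjacent (V - g \<cdot> X) X"
    and inside: "\<exists>Y\<in>\<E>. Y \<subset> V - X" "\<exists>Y\<in>\<E>. Y \<subset> X"
  shows "\<exists>P Q. is_amalgamated_product G P Q edge_stabilizer \<and> P \<noteq> edge_stabilizer \<and> edge_stabilizer \<noteq> Q"
proof -
  let ?P = "vertex_stabilizer X" and ?Q = "vertex_stabilizer (V - X)"
  have compl: "g \<cdot> (V - X) = V - g \<cdot> X" if "g \<in> carrier G" for g
    using translate_compl that X_sub by blast
  have dd: "V - (V - X) = X" using X_sub by blast
  have stab: "g \<in> edge_stabilizer" if "g \<in> carrier G" "g \<cdot> (V - X) = V - X" for g
    using that compl[OF that(1)] translate_closed[OF that(1) X_sub] X_sub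
    by (auto simp: edge_stabilizer_def)
  have pong: "q \<cdot> (V - X) \<subseteq> X" if "q \<in> ?Q" "q \<notin> edge_stabilizer" for q
  proof -
    have "q \<cdot> (V - X) \<noteq> V - X" using that stab by (auto simp: vertex_stabilizer_def)
    then show ?thesis using vertex_stabilizer_moves[OF compl_X_in that(1)] dd by blast
  qed
  have mixed: "\<not> adjacent (g \<cdot> X) (V - h \<cdot> X)" if gh: "g \<in> carrier G" "h \<in> carrier G" for g h
  proof
    assume "adjacent (g \<cdot> X) (V - h \<cdot> X)"
    then have "adjacent (inv g \<cdot> g \<cdot> X) (inv g \<cdot> (V - h \<cdot> X))" using adjacent_translate gh by simp
    then have "adjacent X (V - (inv g \<otimes> h) \<cdot> X)"
      using gh X_sub translate_closed[of h X]
      by (simp add: translate_inv translate_compl translate_mult)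
    then show False using two[of "inv g \<otimes> h"] adjacent_sym gh by simp
  qed
  have PQ: "?P \<union> ?Q \<subseteq> carrier G" by (auto simp: vertex_stabilizer_def)
  let ?N = "generate G (?P \<union> ?Q)"
  note N = subgroup_generate_sub[OF PQ]
  note NG = subgroup.mem_carrier[OF N(1)]
  have "?N = carrier G"
  proof (rule EE_generated[OF N(1)])
    show "edge_stabilizer \<subseteq> ?N" using edge_stabilizer_sub N(2) by blast
    show "g \<in> ?N" if "g \<in> carrier G" "g \<cdot> X = V - X" for g using that no_inversion by blast
  next
    fix g Y assume g: "g \<in> ?N" "adjacent (g \<cdot> X) Y"
    then obtain h where h: "h \<in> carrier G" "Y = h \<cdot> X"
      using mixed NG by (metis EE_cases adjacent_in(2))
    then have "inv g \<otimes> h \<in> ?P" using g NG vertex_stabilizer_iff X_in by blast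
    then have "h \<in> ?N" using subgroup_divide[OF N(1) g(1) h(1)] N(2) by blast
    then show "\<exists>h\<in>?N. Y = h \<cdot> X \<or> Y = V - h \<cdot> X" using h by blast
  next
    fix g Y assume g: "g \<in> ?N" "adjacent (V - g \<cdot> X) Y"
    then obtain h where h: "h \<in> carrier G" "Y = V - h \<cdot> X"
      using mixed NG adjacent_sym by (metis EE_cases adjacent_in(2))
    then have "adjacent (g \<cdot> (V - X)) (h \<cdot> (V - X))" using g NG compl by simp
    then have "inv g \<otimes> h \<in> ?Q" using g NG vertex_stabilizer_iff compl_X_in h by blast
    then have "h \<in> ?N" using subgroup_divide[OF N(1) g(1) h(1)] N(2) by blast
    then show "\<exists>h\<in>?N. Y = h \<cdot> X \<or> Y = V - h \<cdot> X" using h by blast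
  qed
  then have "is_amalgamated_product G ?P ?Q edge_stabilizer"
    using is_amalgamated_product_stabilizers[OF subgroup_vertex_stabilizer[OF compl_X_in]
        edge_stabilizer_sub(2) pong] by blast
  moreover have "?P \<noteq> edge_stabilizer"
  proof -
    obtain W where W: "adjacent W X" "W \<noteq> X" using edge_inside_translate inside(1) X_in by metis
    obtain h where h: "h \<in> carrier G" "W = h \<cdot> X"
      using adjacent_in(1)[OF W(1)] two W(1) by (metis EE_cases)
    then have "h \<in> ?P" "h \<notin> edge_stabilizer" using W by (auto simp: vertex_stabilizer_def edge_stabilizer_def)
    then show ?thesis by blast
  qed
  moreover have "?Q \<noteq> edge_stabilizer"
  proof -
    obtain W where W: "adjacent W (V - X)" "W \<noteq> V - X"
      using edge_inside_translate[of "V - X"] inside(2) compl_X_in dd by metis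
    obtain h where h: "h \<in> carrier G" "W = V - h \<cdot> X"
      using adjacent_in(1)[OF W(1)] mixed[of _ \<one>] W(1) translate_one[OF X_sub] by (metis EE_cases one_closed)
    then have "h \<in> ?Q" "h \<notin> edge_stabilizer"
      using W compl by (auto simp: vertex_stabilizer_def edge_stabilizer_def)
    then show ?thesis by blast
  qed
  ultimately show ?thesis by blast
qed

text \<open>\<open>X\<close> and \<open>V - t \<cdot> X\<close> start at the same vertex, so their
  translates by its stabilizer are pairwise equal or disjoint. \<open>t\<close> maps the complement
  of \<open>X\<close> onto \<open>V - t \<cdot> X\<close>, and its inverse maps the complement of
  \<open>V - t \<cdot> X\<close> onto \<open>X\<close>. Britton reducedness ensures that the set
  reached so far lies in the complement on which the next stable letter acts.\<close>

lemma hnn_ping_pong: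
  assumes no_inversion: "\<And>g. g \<in> carrier G \<Longrightarrow> g \<cdot> X \<noteq> V - X"
    and t: "t \<in> carrier G" "adjacent (V - t \<cdot> X) X"
    and w: "w \<in> lists (Base ` vertex_stabilizer X \<union> {Stable, StableInv})"
      "britton_reduced edge_stabilizer ((\<lambda>c. t \<otimes> c \<otimes> inv t) ` edge_stabilizer) w"
      "set w \<inter> {Stable, StableInv} \<noteq> {}"
  shows "word_val G (hnn_val t) w \<noteq> \<one>"
proof
  let ?P = "vertex_stabilizer X" and ?S = "{Stable, StableInv} :: 'a hnn_letter set"
  let ?val = "word_val G (hnn_val t)"
  \<comment> \<open>A stable letter \<open>l\<close> moves the complement of
    \<open>target (opp l)\<close> onto \<open>target l\<close>, where \<open>opp l\<close> is its
    inverse letter.\<close>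
  define target where "target l = (if l = Stable then V - t \<cdot> X else X)" for l :: "'a hnn_letter"
  define opp :: "'a hnn_letter \<Rightarrow> 'a hnn_letter" where
    "opp l = (if l = Stable then StableInv else Stable)" for l
  have PG: "p \<in> carrier G" if "p \<in> ?P" for p using that by (simp add: vertex_stabilizer_def)
  have P: "subgroup ?P G" using subgroup_vertex_stabilizer X_in .
  interpret PT: letters G "Base ` ?P \<union> ?S" "hnn_val t"
    using PG t(1) by unfold_locales auto
  have tX: "t \<cdot> X \<subseteq> V" using t translate_closed X_sub by blast
  have target_V: "target l \<subseteq> V" for l using X_sub by (auto simp: target_def)
  have target_adj: "adjacent (target l) X" for l
    using t(2) adjacent_refl X_in by (simp add: target_def)
  have move: "hnn_val t l \<cdot> (V - target (opp l)) = target l" if "l \<in> ?S" for l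
  proof -
    have "inv t \<cdot> t \<cdot> X = X" using t X_sub translate_inv by blast
    moreover have "V - (V - t \<cdot> X) = t \<cdot> X" using tX by blast
    ultimately show ?thesis using that t X_sub by (auto simp: target_def opp_def translate_compl)
  qed
  \<comment> \<open>The coincidences that would stop the ping-pong. They occur only for elements
    that \<open>britton_reduced\<close> forbids between two opposite stable letters.\<close>
  have eq_case: "l = l' \<and> (l = StableInv \<longrightarrow> p \<in> edge_stabilizer) \<and>
      (l = Stable \<longrightarrow> p \<in> (\<lambda>c. t \<otimes> c \<otimes> inv t) ` edge_stabilizer)"
    if p: "p \<in> carrier G" and l: "l \<in> ?S" "l' \<in> ?S" and eq: "p \<cdot> target l = target l'" for p l l'
  proof -
    have ptX: "p \<cdot> t \<cdot> X \<subseteq> V" using p tX translate_closed by blast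
    have comp: "p \<cdot> (V - t \<cdot> X) = V - (p \<otimes> t) \<cdot> X"
      using p t tX X_sub by (simp add: translate_compl translate_mult)
    have ne: "(p \<otimes> t) \<cdot> X \<noteq> V - X" using no_inversion p t by simp
    have ne': "p \<cdot> X \<noteq> V - t \<cdot> X"
    proof
      assume "p \<cdot> X = V - t \<cdot> X"
      then have "p \<cdot> X = t \<cdot> (V - X)" using t X_sub translate_compl by simp
      then have "inv t \<cdot> p \<cdot> X = V - X" using t X_sub translate_inv(1)[of t "V - X"] by simp
      then show False using no_inversion[of "inv t \<otimes> p"] p t X_sub by (simp add: translate_mult)
    qed
    consider "l = StableInv" "l' = StableInv" | "l = Stable" "l' = Stable" | "l = StableInv" "l' = Stable"
      | "l = Stable" "l' = StableInv" using l by auto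
    then show ?thesis
    proof cases
      case 1
      then show ?thesis using eq p by (simp add: target_def edge_stabilizer_def)
    next
      case 2
      then have "V - (p \<otimes> t) \<cdot> X = V - t \<cdot> X" using eq comp by (simp add: target_def)
      then have "(p \<otimes> t) \<cdot> X = t \<cdot> X"
        using tX translate_closed[of "p \<otimes> t" X] p t X_sub by (metis double_diff m_closed order_refl)
      then have "inv t \<otimes> (p \<otimes> t) \<in> edge_stabilizer" using edge_stabilizer_iff[of t "p \<otimes> t"] p t by simp
      moreover have "p = t \<otimes> (inv t \<otimes> (p \<otimes> t)) \<otimes> inv t"
        using p t by (simp add: m_assoc[symmetric]) (simp add: m_assoc)
      ultimately show ?thesis using 2 by blast
    next
      case 3
      then show ?thesis using eq ne' by (simp add: target_def)
    next
      case 4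
      then have "V - (p \<otimes> t) \<cdot> X = X" using eq comp by (simp add: target_def)
      then show ?thesis using ne translate_closed[of "p \<otimes> t" X] p t X_sub
        by (metis double_diff m_closed order_refl)
    qed
  qed
  have adj: "adjacent (p \<cdot> target l) (target l')" if "p \<in> ?P" for p l l'
  proof -
    have "adjacent (p \<cdot> target l) (p \<cdot> X)" "adjacent (p \<cdot> X) X"
      using that adjacent_translate target_adj by (auto simp: vertex_stabilizer_def)
    then show ?thesis using adjacent_trans adjacent_sym target_adj by metis
  qed
  note bred = w(2)[unfolded britton_reduced_def, rule_format]
  \<comment> \<open>The base letters after the last stable letter are cut off; their product lies in
    the vertex stabilizer and is accounted for at the end.\<close>
  obtain u s bs where usb: "w = u @ s # bs" "s \<in> ?S" "\<forall>b\<in>set bs. b \<notin> ?S"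
    using split_list_last_prop[of w "\<lambda>l. l \<in> ?S"] w(3) by blast
  define Z where "Z = V - target (opp s)"
  have ZV: "Z \<subseteq> V" by (auto simp: Z_def)
  \<comment> \<open>\<open>p\<close> is the leading base letter, or \<open>\<one>\<close> if the
    word starts with the stable letter \<open>l\<close>. It is kept apart because only the next
    stable letter on the left decides whether there is a pinch.\<close>
  have claim: "\<exists>p\<in>?P. \<exists>l\<in>?S. \<exists>v. (y = Base p # l # v \<or> y = l # v \<and> p = \<one>) \<and> ?val y \<cdot> Z \<subseteq> p \<cdot> target l"
    if "w = x @ y' @ s # bs" "y = y' @ [s]" for x y y'
    using that
  proof (induction y' arbitrary: x y)
    case Nil
    have "?val [s] \<cdot> Z = \<one> \<cdot> target s"
      using move[OF usb(2)] PT.f_closed[of s] usb(2) target_V translate_one by (auto simp: Z_def)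
    then show ?case using Nil usb(2) subgroup.one_closed[OF P] by auto
  next
    case (Cons a y')
    let ?y = "y' @ [s]"
    have y: "y = a # ?y" "w = (x @ [a]) @ y' @ s # bs" using Cons.prems by auto
    obtain p l v where IH: "p \<in> ?P" "l \<in> ?S" "?y = Base p # l # v \<or> ?y = l # v \<and> p = \<one>"
      "?val ?y \<cdot> Z \<subseteq> p \<cdot> target l"
      using Cons.IH[OF y(2) HOL.refl] by blast
    have wy: "w = x @ a # ?y @ bs" using y(2) by simp
    have yl: "?y \<in> lists (Base ` ?P \<union> ?S)" "a \<in> Base ` ?P \<union> ?S" using w(1) y by auto
    then have vy: "?val ?y \<in> carrier G" by simp
    have val: "?val y \<cdot> Z = hnn_val t a \<cdot> ?val ?y \<cdot> Z"
      using y(1) translate_mult[OF PT.f_closed[OF yl(2)] vy ZV] by simp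
    show ?case
    proof (cases "a \<in> ?S")
      case False
      then obtain q where q: "a = Base q" "q \<in> ?P" using yl by auto
      have "?y \<noteq> Base p # l # v"
      proof
        assume "?y = Base p # l # v"
        then have "w = x @ [Base q, Base p] @ (l # v @ bs)" using wy q by simp
        then show False using bred[of x "[Base q, Base p]" "l # v @ bs"] by blast
      qed
      then have *: "?y = l # v" "p = \<one>" using IH(3) by auto
      then have "?val ?y \<cdot> Z \<subseteq> target l" using IH(4) target_V translate_one by simp
      then have "?val y \<cdot> Z \<subseteq> q \<cdot> target l" unfolding val using q translate_mono by simp
      then show ?thesis using q * y(1) IH(2) by blast
    next
      case True
      have ne: "p \<cdot> target l \<noteq> target (opp a)"
      proof
        assume eq: "p \<cdot> target l = target (opp a)"
        have "opp a \<in> ?S" by (simp add: opp_def)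
        note c = eq_case[OF PG[OF IH(1)] IH(2) this eq]
        show False using IH(3)
        proof
          assume "?y = Base p # l # v"
          then have "w = x @ [a, Base p, l] @ (v @ bs)" unfolding wy by simp
          note b = bred[OF this]
          show False using True
          proof (elim insertE emptyE)
            assume a: "a = Stable"
            then have "l = StableInv" "p \<in> edge_stabilizer" using c by (auto simp: opp_def)
            then show False using b a by blast
          next
            assume a: "a = StableInv"
            then have "l = Stable" "p \<in> (\<lambda>c. t \<otimes> c \<otimes> inv t) ` edge_stabilizer"
              using c by (simp_all add: opp_def)
            then show False using b a by blast
          qed
        next
          assume "?y = l # v \<and> p = \<one>"
          then have "w = x @ [a, l] @ (v @ bs)" unfolding wy by simp
          note b = bred[OF this]
          have "l = opp a" using c by blast
          then have "[a, l] = [Stable, StableInv] \<or> [a, l] = [StableInv, Stable]"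
            using True by (simp add: opp_def split: if_splits)
          then show False using b by blast
        qed
      qed
      then have "p \<cdot> target l \<subseteq> V - target (opp a)" using adjacentD[OF adj[OF IH(1)]] by blast
      then have "?val ?y \<cdot> Z \<subseteq> V - target (opp a)" using IH(4) by blast
      then have "?val y \<cdot> Z \<subseteq> \<one> \<cdot> target a"
        unfolding val using move[OF True] translate_mono translate_one[OF target_V] by metis
      then show ?thesis using y(1) True subgroup.one_closed[OF P] by blast
    qed
  qed
  obtain p l where pl: "p \<in> ?P" "l \<in> ?S" "?val (u @ [s]) \<cdot> Z \<subseteq> p \<cdot> target l"
    using claim[of "[]" u] usb(1) by auto
  have bsP: "?val bs \<in> ?P"
  proof -
    have "set bs \<subseteq> Base ` ?P" using w(1) usb by auto
    then show ?thesis
      by (induction bs) (auto intro: subgroup.one_closed[OF P] subgroup.m_closed[OF P])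
  qed
  assume "?val w = \<one>"
  have lists: "u @ [s] \<in> lists (Base ` ?P \<union> ?S)" "bs \<in> lists (Base ` ?P \<union> ?S)" using w(1) usb(1) by auto
  then have "?val w = ?val (u @ [s]) \<otimes> ?val bs" using PT.word_val_append[OF lists] usb(1) by simp
  then have inv: "?val (u @ [s]) = inv (?val bs)"
    using \<open>?val w = \<one>\<close> lists PT.word_val_closed inv_equality by metis
  then have q: "?val (u @ [s]) \<in> ?P" using bsP subgroup.m_inv_closed[OF P] by simp
  \<comment> \<open>If the whole word has value \<open>\<one>\<close>, the part up to the last
    stable letter has its value in \<open>?P\<close>, so \<open>r\<close> fixes the base
    vertex.\<close>
  define r where "r = inv p \<otimes> ?val (u @ [s])"
  have r: "r \<in> ?P" using q pl(1) subgroup.m_inv_closed[OF P] subgroup.m_closed[OF P] by (simp add: r_def)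
  have "inv p \<cdot> ?val (u @ [s]) \<cdot> Z \<subseteq> inv p \<cdot> p \<cdot> target l" using pl(3) by (rule translate_mono)
  then have "r \<cdot> Z \<subseteq> target l"
    using translate_mult[OF _ PG[OF q] ZV, of "inv p"] PG[OF pl(1)] translate_inv(1)[OF _ target_V]
    by (simp add: r_def)
  then have sub: "V - r \<cdot> target (opp s) \<subseteq> target l"
    using PG[OF r] target_V by (simp add: Z_def translate_compl)
  \<comment> \<open>\<open>?Y\<close> and \<open>target l\<close> are adjacent and cover
    \<open>V\<close>; but adjacent edges are equal, or disjoint without covering \<open>V\<close>,
    and no edge is all of \<open>V\<close>.\<close>
  let ?Y = "r \<cdot> target (opp s)"
  have Y: "adjacent ?Y (target l)" using adj r by blast
  then have "V - ?Y \<noteq> {}" using EE_nonempty EE_compl adjacent_in by blast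
  moreover have "?Y \<subseteq> V" using Y adjacent_in EE_sub by blast
  ultimately show False using adjacentD[OF Y] sub target_V by blast
qed

text \<open>The vertices form one orbit: \<open>t\<close> takes the far end of \<open>X\<close> to
  its near end. An edge \<open>V - h \<cdot> X\<close> shares its vertex with a translate of
  \<open>X\<close>, namely by \<open>h \<otimes> inv t\<close>; hence \<open>t\<close> and the
  vertex stabilizer generate \<open>G\<close>.\<close>

lemma splitting_loop:
  assumes no_inversion: "\<And>g. g \<in> carrier G \<Longrightarrow> g \<cdot> X \<noteq> V - X"
    and t: "t \<in> carrier G" "adjacent (V - t \<cdot> X) X"
  shows "is_hnn_extension G (vertex_stabilizer X) edge_stabilizer"
proof (rule is_hnn_extensionI[OF subgroup_vertex_stabilizer[OF X_in] subgroup_edge_stabilizer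
      edge_stabilizer_sub(1) t(1)])
  let ?P = "vertex_stabilizer X"
  have compl: "g \<cdot> (V - X) = V - g \<cdot> X" if "g \<in> carrier G" for g
    using translate_compl that X_sub by blast
  have KG: "edge_stabilizer \<subseteq> carrier G" by (auto simp: edge_stabilizer_def)
  \<comment> \<open>\<open>c\<close> fixes \<open>X\<close>, so its conjugate fixes
    \<open>t \<cdot> X\<close> and hence the base vertex, from which \<open>V - t \<cdot> X\<close>
    points away.\<close>
  show "t \<otimes> c \<otimes> inv t \<in> ?P" if c: "c \<in> edge_stabilizer" for c
  proof -
    let ?d = "t \<otimes> c \<otimes> inv t"
    have cG: "c \<in> carrier G" "c \<cdot> X = X" using c by (auto simp: edge_stabilizer_def)
    have tX: "t \<cdot> X \<subseteq> V" using translate_closed t X_sub by blast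
    have "?d \<cdot> t \<cdot> X = t \<cdot> X"
      using cG t X_sub tX by (simp add: translate_mult translate_inv translate_closed)
    then have "?d \<cdot> (V - t \<cdot> X) = V - t \<cdot> X" using translate_compl cG t tX by simp
    moreover have "adjacent (?d \<cdot> (V - t \<cdot> X)) (?d \<cdot> X)" using adjacent_translate t cG by simp
    ultimately have "adjacent (?d \<cdot> X) X" using adjacent_sym adjacent_trans t(2) by metis
    then show ?thesis using cG t by (simp add: vertex_stabilizer_def)
  qed
  have PG: "insert t ?P \<subseteq> carrier G" using t by (auto simp: vertex_stabilizer_def)
  let ?N = "generate G (insert t ?P)"
  note N = subgroup_generate_sub[OF PG]
  note NG = subgroup.mem_carrier[OF N(1)]
  have tN: "t \<in> ?N" "inv t \<in> ?N" using N subgroup.m_inv_closed[OF N(1)] by auto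
  have step: "\<exists>h\<in>?N. Y = h \<cdot> X \<or> Y = V - h \<cdot> X" if g: "g \<in> ?N" "adjacent (g \<cdot> X) Y" for g Y
  proof -
    note gG = NG[OF g(1)]
    show ?thesis using adjacent_in(2)[OF g(2)]
    proof (rule EE_cases)
      fix h assume h: "h \<in> carrier G" "Y = h \<cdot> X"
      then have "inv g \<otimes> h \<in> ?P" using g gG vertex_stabilizer_iff X_in by blast
      then have "h \<in> ?N" using subgroup_divide[OF N(1) g(1) h(1)] N(2) by blast
      then show ?thesis using h by blast
    next
      fix h assume h: "h \<in> carrier G" "Y = V - h \<cdot> X"
      \<comment> \<open>\<open>h \<otimes> inv t\<close> carries the pair
        \<open>V - t \<cdot> X\<close>, \<open>X\<close> at the base vertex to
        \<open>V - h \<cdot> X\<close> and a translate of \<open>X\<close> at the vertex of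
        \<open>V - h \<cdot> X\<close>.\<close>
      have "(h \<otimes> inv t) \<cdot> t \<cdot> X = h \<cdot> X"
        using h t X_sub translate_closed[OF t(1) X_sub] by (simp add: translate_mult translate_inv)
      then have eq: "(h \<otimes> inv t) \<cdot> (V - t \<cdot> X) = V - h \<cdot> X"
        using h t translate_closed[OF t(1) X_sub] by (simp add: translate_compl)
      have "adjacent ((h \<otimes> inv t) \<cdot> (V - t \<cdot> X)) ((h \<otimes> inv t) \<cdot> X)"
        using adjacent_translate h t by simp
      then have "adjacent (g \<cdot> X) ((h \<otimes> inv t) \<cdot> X)" using eq g(2) h(2) adjacent_trans by metis
      then have "inv g \<otimes> (h \<otimes> inv t) \<in> ?P"
        using gG vertex_stabilizer_iff[OF gG _ X_in] h t by simp
      then have "h \<otimes> inv t \<in> ?N" using subgroup_divide[OF N(1) g(1), of "h \<otimes> inv t"] N(2) h t by blast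
      then have "(h \<otimes> inv t) \<otimes> t \<in> ?N" using subgroup.m_closed[OF N(1)] tN by blast
      then have "h \<in> ?N" using h t by (simp add: m_assoc)
      then show ?thesis using h by blast
    qed
  qed
  show "?N = carrier G"
  proof (rule EE_generated[OF N(1)])
    show "edge_stabilizer \<subseteq> ?N" using edge_stabilizer_sub(1) N(2) by blast
    show "g \<in> ?N" if "g \<in> carrier G" "g \<cdot> X = V - X" for g using that no_inversion by blast
  next
    fix g Y assume g: "g \<in> ?N" "adjacent (V - g \<cdot> X) Y"
    note gG = NG[OF g(1)]
    have "(g \<otimes> inv t) \<cdot> t \<cdot> X = g \<cdot> X"
      using gG t X_sub translate_closed[OF t(1) X_sub] by (simp add: translate_mult translate_inv)
    then have "(g \<otimes> inv t) \<cdot> (V - t \<cdot> X) = V - g \<cdot> X"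
      using gG t translate_closed[OF t(1) X_sub] by (simp add: translate_compl)
    moreover have "adjacent ((g \<otimes> inv t) \<cdot> (V - t \<cdot> X)) ((g \<otimes> inv t) \<cdot> X)"
      using adjacent_translate gG t by simp
    ultimately have "adjacent ((g \<otimes> inv t) \<cdot> X) Y" using g(2) adjacent_sym adjacent_trans by metis
    moreover have "g \<otimes> inv t \<in> ?N" using g(1) tN subgroup.m_closed[OF N(1)] by blast
    ultimately show "\<exists>h\<in>?N. Y = h \<cdot> X \<or> Y = V - h \<cdot> X" using step by blast
  qed (rule step)
  show "word_val G (hnn_val t) w \<noteq> \<one>"
    if "w \<in> lists (Base ` ?P \<union> {Stable, StableInv})"
      "britton_reduced edge_stabilizer ((\<lambda>c. t \<otimes> c \<otimes> inv t) ` edge_stabilizer) w"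
      "set w \<inter> {Stable, StableInv} \<noteq> {}" for w
    using hnn_ping_pong[OF no_inversion t that] .
qed

theorem splits_over_edge_stabilizer:
  assumes "\<exists>Y\<in>\<E>. Y \<subset> V - X" "\<exists>Y\<in>\<E>. Y \<subset> X"
  shows "splits_nontrivially_over G edge_stabilizer"
proof (cases "\<exists>s\<in>carrier G. s \<cdot> X = V - X")
  case True
  then show ?thesis using splitting_inversion assms(1) by (auto simp: splits_nontrivially_over_def)
next
  case no_inversion: False
  show ?thesis
  proof (cases "\<exists>t\<in>carrier G. adjacent (V - t \<cdot> X) X")
    case True
    then show ?thesis using splitting_loop no_inversion unfolding splits_nontrivially_over_def by blast
  next
    case False
    then show ?thesis
      using splitting_two_vertices assms no_inversion unfolding splits_nontrivially_over_def by blast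
  qed
qed

end

section \<open>The coset graph of a commensurated subgroup\<close>

text \<open>On \<open>A\<close>, \<open>g\<close> is a function of \<open>f\<close>. Used to pass
  from one kind of coset or translate to another.\<close>

lemma finite_image_factor:
  assumes "finite (f ` A)" "\<And>x y. x \<in> A \<Longrightarrow> y \<in> A \<Longrightarrow> f x = f y \<Longrightarrow> g x = g y"
  shows "finite (g ` A)"
proof -
  have "g x = g (SOME z. z \<in> A \<and> f z = f x)" if "x \<in> A" for x
  proof -
    have "(SOME z. z \<in> A \<and> f z = f x) \<in> A \<and> f (SOME z. z \<in> A \<and> f z = f x) = f x"
      by (rule someI[of _ x]) (simp add: that)
    then show ?thesis using assms(2) that by metis
  qed
  then have "g ` A \<subseteq> (\<lambda>b. g (SOME z. z \<in> A \<and> f z = b)) ` f ` A" by auto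
  then show ?thesis using assms(1) finite_surj by blast
qed

context group
begin

lemma lcoset_eq_iff:
  assumes H: "subgroup H G" and x: "x \<in> carrier G" and y: "y \<in> carrier G"
  shows "x <# H = y <# H \<longleftrightarrow> inv x \<otimes> y \<in> H"
proof
  assume "x <# H = y <# H"
  moreover have "y \<in> y <# H"
    using y subgroup.one_closed[OF H] by (auto simp: l_coset_def intro!: bexI[of _ \<one>])
  ultimately obtain h where "h \<in> H" "y = x \<otimes> h" by (auto simp: l_coset_def)
  then show "inv x \<otimes> y \<in> H" using x subgroup.mem_carrier[OF H] by (simp add: m_assoc[symmetric])
next
  assume h: "inv x \<otimes> y \<in> H"
  have "y <# H = (x \<otimes> (inv x \<otimes> y)) <# H" using x y by (simp add: m_assoc[symmetric])
  also have "\<dots> = x <# ((inv x \<otimes> y) <# H)"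
    using lcos_m_assoc[OF subgroup.subset[OF H] x] x y by simp
  also have "(inv x \<otimes> y) <# H = H" using coset_join3[OF _ H h] x y by simp
  finally show "x <# H = y <# H" by simp
qed

lemma mem_lcoset_iff:
  assumes H: "subgroup H G" and x: "x \<in> carrier G" and y: "y \<in> carrier G"
  shows "y \<in> x <# H \<longleftrightarrow> x <# H = y <# H"
proof
  assume "y \<in> x <# H"
  then obtain h where "h \<in> H" "y = x \<otimes> h" by (auto simp: l_coset_def)
  then show "x <# H = y <# H"
    using x y subgroup.mem_carrier[OF H] lcoset_eq_iff[OF H x y] by (simp add: m_assoc[symmetric])
next
  assume "x <# H = y <# H"
  then have "inv x \<otimes> y \<in> H" using lcoset_eq_iff[OF H x y] by simp
  moreover have "y = x \<otimes> (inv x \<otimes> y)" using x y by (simp add: m_assoc[symmetric])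
  ultimately show "y \<in> x <# H" by (auto simp: l_coset_def)
qed

lemma rcoset_eqI:
  assumes H: "subgroup H G" and x: "x \<in> carrier G" and y: "y \<in> carrier G" and "x \<otimes> inv y \<in> H"
  shows "H #> x = H #> y"
proof -
  have "x = (x \<otimes> inv y) \<otimes> y" using x y by (simp add: m_assoc)
  then have "x \<in> H #> y" using assms(4) by (auto simp: r_coset_def)
  then show ?thesis using repr_independence[OF _ y H] by simp
qed

text \<open>Meant for orbit maps. These are taken at inverses, as in \<open>inv k <# H\<close>,
  because the index is defined through right cosets while the actions are from the left.\<close>

lemma finite_indexI:
  assumes L: "subgroup L G" and D: "subgroup D G" "D \<subseteq> L"
    and fin: "finite (f ` L)" and f: "\<And>x y. x \<in> L \<Longrightarrow> y \<in> L \<Longrightarrow> f x = f y \<Longrightarrow> x \<otimes> inv y \<in> D"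
  shows "finite_index G D L"
proof -
  have "finite ((\<lambda>x. D #> x) ` L)"
    using fin
  proof (rule finite_image_factor)
    fix x y assume "x \<in> L" "y \<in> L" "f x = f y"
    then show "D #> x = D #> y" using rcoset_eqI[OF D(1)] f subgroup.mem_carrier[OF L] by blast
  qed
  moreover have "rcosets\<^bsub>G\<lparr>carrier := L\<rparr>\<^esub> D = (\<lambda>x. D #> x) ` L"
    by (auto simp: RCOSETS_def r_coset_def)
  ultimately show ?thesis
    using subgroup_incl[OF D(1) L D(2)] by (simp add: finite_index_def)
qed

end

section \<open>Left versus right cosets of a commensurated subgroup\<close>

locale generated_commensurated = group G for G :: "('a, 'b) monoid_scheme" (structure) +
  fixes H S :: "'a set"
  assumes H_commensurated: "commensurated G H"
    and S_finite: "finite S" and S_sub: "S \<subseteq> carrier G" and S_gen: "generate G S = carrier G"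
begin

lemma H: "subgroup H G"
  using H_commensurated by (simp add: commensurated_def)

lemma H_sub: "H \<subseteq> carrier G"
  using H by (rule subgroup.subset)

text \<open>Orbit and stabilizer: \<open>H\<close> permutes the left cosets in \<open>H s H\<close>
  transitively, and the stabilizer of \<open>s <# H\<close> is \<open>D\<close>, which has finite
  index in \<open>H\<close>. The inverse in \<open>D #> inv h\<close> turns right cosets of
  \<open>D\<close> into points of the orbit.\<close>

lemma finite_double_coset:
  assumes s: "s \<in> carrier G"
  shows "finite ((\<lambda>h. (h \<otimes> s) <# H) ` H)"
proof -
  define D where "D = H \<inter> (s <# H #> inv s)"
  have "finite (rcosets\<^bsub>G\<lparr>carrier := H\<rparr>\<^esub> D)"
    using H_commensurated s by (auto simp: commensurated_def commensurable_def finite_index_def D_def)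
  moreover have "(\<lambda>h. D #> inv h) ` H \<subseteq> rcosets\<^bsub>G\<lparr>carrier := H\<rparr>\<^esub> D"
    using subgroup.m_inv_closed[OF H] by (auto simp: RCOSETS_def r_coset_def)
  ultimately have "finite ((\<lambda>h. D #> inv h) ` H)" by (rule rev_finite_subset)
  then show ?thesis
  proof (rule finite_image_factor)
    fix x y assume xy: "x \<in> H" "y \<in> H" and eq: "D #> inv x = D #> inv y"
    have xyG: "x \<in> carrier G" "y \<in> carrier G" using xy H_sub by auto
    have "\<one> \<in> s <# H #> inv s"
      using s subgroup.one_closed[OF H] by (auto simp: l_coset_def r_coset_def intro!: bexI[of _ \<one>])
    then have "\<one> \<in> D" using subgroup.one_closed[OF H] by (simp add: D_def)
    then have "inv x \<in> D #> inv x" using xyG by (auto simp: r_coset_def intro!: bexI[of _ \<one>])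
    then obtain d where d: "d \<in> D" "inv x = d \<otimes> inv y" using eq by (auto simp: r_coset_def)
    then obtain h where h: "h \<in> H" "d = s \<otimes> h \<otimes> inv s"
      by (auto simp: D_def l_coset_def r_coset_def)
    have hG: "h \<in> carrier G" using h H_sub by blast
    have "inv (x \<otimes> s) \<otimes> (y \<otimes> s) = inv s \<otimes> (inv x \<otimes> y) \<otimes> s"
      using s xyG by (simp add: inv_mult_group m_assoc)
    also have "inv x \<otimes> y = d" using d(2) xyG h(2) hG s by (simp add: m_assoc)
    also have "inv s \<otimes> d \<otimes> s = h"
    proof -
      have "inv s \<otimes> (s \<otimes> h \<otimes> inv s) \<otimes> s = (inv s \<otimes> s) \<otimes> h \<otimes> (inv s \<otimes> s)"
        using s hG by (simp only: m_assoc m_closed inv_closed)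
      then show ?thesis using s hG h(2) by simp
    qed
    finally show "(x \<otimes> s) <# H = (y \<otimes> s) <# H"
      using lcoset_eq_iff[OF H] s xyG h(1) by simp
  qed
qed

text \<open>A right coset \<open>H #> g\<close> meets only the left cosets in its double
  coset.\<close>

lemma finite_left_cosets:
  assumes "H_finite G H B"
  shows "finite ((\<lambda>x. x <# H) ` B)"
proof -
  obtain F where F: "finite F" "F \<subseteq> rcosets H" "B \<subseteq> \<Union>F" using assms by (auto simp: H_finite_def)
  have "finite ((\<lambda>x. x <# H) ` Z)" if Z: "Z \<in> F" for Z
  proof -
    obtain g where g: "g \<in> carrier G" "Z = H #> g" using F Z by (auto simp: RCOSETS_def)
    have "(\<lambda>x. x <# H) ` Z = (\<lambda>h. (h \<otimes> g) <# H) ` H" by (auto simp: g(2) r_coset_def)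
    then show ?thesis using finite_double_coset[OF g(1)] by simp
  qed
  then have "finite ((\<lambda>x. x <# H) ` \<Union>F)" using F(1) by (simp add: image_Union)
  then show ?thesis using F(3) by (meson finite_subset image_mono)
qed

text \<open>Inversion exchanges left and right cosets, so the bound on double cosets applies to the
  inverses.\<close>

lemma H_finite_left_cosets:
  assumes B: "B \<subseteq> carrier G" and fin: "finite ((\<lambda>x. x <# H) ` B)"
  shows "H_finite G H B"
proof -
  have "(\<lambda>b. inv b <# H) ` B \<subseteq> (\<Union>v\<in>(\<lambda>x. x <# H) ` B. (\<lambda>b. inv b <# H) ` (v \<inter> carrier G))"
    using B mem_lcoset_iff[OF H] by blast
  moreover have "finite ((\<lambda>b. inv b <# H) ` (v \<inter> carrier G))" if v: "v \<in> (\<lambda>x. x <# H) ` B" for v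
  proof -
    obtain x where x: "x \<in> carrier G" "v = x <# H" using v B by auto
    have "(\<lambda>b. inv b <# H) ` (v \<inter> carrier G) \<subseteq> (\<lambda>h. (h \<otimes> inv x) <# H) ` H"
    proof
      fix w assume "w \<in> (\<lambda>b. inv b <# H) ` (v \<inter> carrier G)"
      then obtain h where h: "h \<in> H" "w = inv (x \<otimes> h) <# H" using x by (auto simp: l_coset_def)
      then have "w = (inv h \<otimes> inv x) <# H" using x H_sub by (auto simp: inv_mult_group)
      then show "w \<in> (\<lambda>h. (h \<otimes> inv x) <# H) ` H" using h subgroup.m_inv_closed[OF H] by blast
    qed
    then show ?thesis using finite_double_coset[of "inv x"] x by (meson finite_subset inv_closed)
  qed
  ultimately have "finite ((\<lambda>b. inv b <# H) ` B)" using fin by (meson finite_UN_I finite_subset)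
  then have "finite ((\<lambda>b. H #> b) ` B)"
  proof (rule finite_image_factor)
    fix x y assume xy: "x \<in> B" "y \<in> B" "inv x <# H = inv y <# H"
    then have xyG: "x \<in> carrier G" "y \<in> carrier G" using B by auto
    then have "x \<otimes> inv y \<in> H" using xy(3) lcoset_eq_iff[OF H, of "inv x" "inv y"] by simp
    then show "H #> x = H #> y" using rcoset_eqI[OF H xyG] by blast
  qed
  moreover have "(\<lambda>b. H #> b) ` B \<subseteq> rcosets H" using B by (auto simp: RCOSETS_def)
  moreover have "B \<subseteq> \<Union>((\<lambda>b. H #> b) ` B)"
    using B rcos_self[OF _ H] by blast
  ultimately show ?thesis unfolding H_finite_def by blast
qed

section \<open>The coset graph and the action on it\<close>

definition vertices :: "'a set set" where
  "vertices = (\<lambda>x. x <# H) ` carrier G"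

text \<open>\<open>x\<close> runs over all representatives, so from the vertex \<open>x <# H\<close>
  the generator \<open>s\<close> leads to every \<open>(x \<otimes> h \<otimes> s) <# H\<close> with
  \<open>h\<close> in \<open>H\<close>. This makes the relation independent of choices;
  \<open>finite_double_coset\<close> keeps it locally finite.\<close>

definition arcs :: "('a set \<times> 'a set) set" where
  "arcs = {(x <# H, (x \<otimes> s) <# H) | x s. x \<in> carrier G \<and> s \<in> S}"

definition edges :: "('a set \<times> 'a set) set" where
  "edges = arcs \<union> arcs\<inverse>"

lemma lcoset_mult: "g \<in> carrier G \<Longrightarrow> x \<in> carrier G \<Longrightarrow> g <# (x <# H) = (g \<otimes> x) <# H"
  using lcos_m_assoc H_sub by blast

lemma vertex_cases:
  assumes "v \<in> vertices"
  obtains x where "x \<in> carrier G" "v = x <# H"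
  using assms by (auto simp: vertices_def)

lemma H_vertex: "H \<in> vertices"
  using lcos_mult_one[OF H_sub] by (force simp: vertices_def)

sublocale action G vertices "\<lambda>g v. g <# v"
proof
  show "g <# v \<in> vertices" if "g \<in> carrier G" "v \<in> vertices" for g v
    using that by (auto elim!: vertex_cases simp: lcoset_mult vertices_def)
  show "\<one> <# v = v" if "v \<in> vertices" for v
    using that by (auto elim!: vertex_cases simp: lcoset_mult)
  show "(g \<otimes> h) <# v = g <# (h <# v)"
    if "g \<in> carrier G" "h \<in> carrier G" "v \<in> vertices" for g h v
    using that by (auto elim!: vertex_cases simp: lcoset_mult m_assoc)
qed

notation translate (infixr "\<cdot>" 75)

lemma finite_neighbours: "v \<in> vertices \<Longrightarrow> finite (edges `` {v})"
proof (elim vertex_cases)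
  fix x assume x: "x \<in> carrier G" "v = x <# H"
  let ?N = "\<lambda>s. (\<lambda>w. x <# w) ` (\<lambda>h. (h \<otimes> s) <# H) ` H"
  have mem: "(y \<otimes> s) <# H \<in> ?N s" if y: "y \<in> carrier G" "x <# H = y <# H" "s \<in> carrier G" for y s
  proof -
    have h: "inv x \<otimes> y \<in> H" using that lcoset_eq_iff[OF H] x by blast
    have "(y \<otimes> s) <# H = x <# (((inv x \<otimes> y) \<otimes> s) <# H)"
      using x y by (simp add: lcoset_mult m_assoc[symmetric])
    then show ?thesis using h by blast
  qed
  have "edges `` {v} \<subseteq> (\<Union>s\<in>S. ?N s \<union> ?N (inv s))"
  proof
    fix w assume "w \<in> edges `` {v}"
    then consider y s where "y \<in> carrier G" "s \<in> S" "v = y <# H" "w = (y \<otimes> s) <# H"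
      | y s where "y \<in> carrier G" "s \<in> S" "v = (y \<otimes> s) <# H" "w = y <# H"
      by (auto simp: edges_def arcs_def)
    then show "w \<in> (\<Union>s\<in>S. ?N s \<union> ?N (inv s))"
    proof cases
      case 1
      then have "w \<in> ?N s" using mem[of y s] x S_sub by auto
      then show ?thesis using 1 by blast
    next
      case 2
      then have sG: "s \<in> carrier G" using S_sub by auto
      have "w = ((y \<otimes> s) \<otimes> inv s) <# H" using 2 sG by (simp add: m_assoc)
      then have "w \<in> ?N (inv s)" using mem[of "y \<otimes> s" "inv s"] 2 sG x by auto
      then show ?thesis using 2 by blast
    qed
  qed
  moreover have "finite (?N s)" if "s \<in> carrier G" for s
    using finite_imageI[OF finite_double_coset[OF that]] .
  then have "finite (\<Union>s\<in>S. ?N s \<union> ?N (inv s))"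
    using S_finite S_sub by (intro finite_UN_I finite_UnI) auto
  ultimately show ?thesis by (rule finite_subset)
qed

lemma edges_translate:
  assumes g: "g \<in> carrier G" and e: "(v, w) \<in> edges"
  shows "(g <# v, g <# w) \<in> edges"
proof -
  have "(g <# v, g <# w) \<in> arcs" if arc: "(v, w) \<in> arcs" for v w
  proof -
    obtain x s where "x \<in> carrier G" "s \<in> S" "v = x <# H" "w = (x \<otimes> s) <# H"
      using arc by (auto simp: arcs_def)
    moreover have "s \<in> carrier G" using S_sub calculation by auto
    ultimately have "g <# v = (g \<otimes> x) <# H" "g <# w = (g \<otimes> x \<otimes> s) <# H" "g \<otimes> x \<in> carrier G" "s \<in> S"
      using g by (simp_all add: lcoset_mult m_assoc)
    then show ?thesis unfolding arcs_def by blast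
  qed
  then show ?thesis using e by (auto simp: edges_def)
qed

lemma edges_generate:
  assumes "x \<in> generate G S" "y \<in> carrier G"
  shows "(y <# H, (y \<otimes> x) <# H) \<in> edges\<^sup>*"
  using assms
proof (induction arbitrary: y rule: generate.induct)
  case one
  then show ?case by simp
next
  case (incl s)
  then show ?case by (intro r_into_rtrancl) (auto simp: edges_def arcs_def)
next
  case (inv s)
  then have "s \<in> carrier G" using S_sub by blast
  then have "y <# H = (y \<otimes> inv s \<otimes> s) <# H" "y \<otimes> inv s \<in> carrier G" using inv by (simp_all add: m_assoc)
  then have "(y \<otimes> inv s <# H, y <# H) \<in> arcs" using inv unfolding arcs_def by blast
  then show ?case by (intro r_into_rtrancl) (auto simp: edges_def)
next
  case (eng g h)
  have gh: "g \<in> carrier G" "h \<in> carrier G" using eng.hyps S_gen by auto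
  then have "(y <# H, (y \<otimes> g) <# H) \<in> edges\<^sup>*" "((y \<otimes> g) <# H, (y \<otimes> g \<otimes> h) <# H) \<in> edges\<^sup>*"
    using eng by auto
  then show ?case using gh eng.prems by (simp add: m_assoc)
qed

sublocale connected_graph vertices edges
proof
  show "edges \<subseteq> vertices \<times> vertices" using S_sub by (auto simp: edges_def arcs_def vertices_def)
  show "sym edges" by (auto simp: edges_def sym_def)
  fix v w assume "v \<in> vertices" "w \<in> vertices"
  then obtain x y where xy: "x \<in> carrier G" "v = x <# H" "y \<in> carrier G" "w = y <# H"
    by (auto elim!: vertex_cases)
  then have "(v, (x \<otimes> (inv x \<otimes> y)) <# H) \<in> edges\<^sup>*" using edges_generate[of "inv x \<otimes> y" x] S_gen by simp
  then show "(v, w) \<in> edges\<^sup>*" using xy by (simp add: m_assoc[symmetric])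
qed

lemma automorphism_translate:
  assumes g: "g \<in> carrier G"
  shows "automorphism (\<lambda>v. g <# v)"
  unfolding automorphism_def
proof (intro conjI ballI)
  show "bij_betw (\<lambda>v. g <# v) vertices vertices" using act_bij[OF g] .
  fix v w assume "v \<in> vertices" "w \<in> vertices"
  then have "inv g <# (g <# v) = v" "inv g <# (g <# w) = w"
    using act_mult[of "inv g" g] act_one g by auto
  then show "(g <# v, g <# w) \<in> edges \<longleftrightarrow> (v, w) \<in> edges"
    using edges_translate[OF g, of v w] edges_translate[of "inv g" "g <# v" "g <# w"] g by auto
qed

section \<open>Cuts of the coset graph\<close>

lemma optimal_translate: "g \<in> carrier G \<Longrightarrow> optimal X \<Longrightarrow> optimal (g \<cdot> X)"
  unfolding translate_def by (rule optimal_image[OF automorphism_translate])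

lemma coboundary_translate:
  assumes g: "g \<in> carrier G" and X: "X \<subseteq> vertices" and e: "(v, w) \<in> coboundary edges X"
  shows "(g <# v, g <# w) \<in> coboundary edges (g \<cdot> X)"
  using coboundary_image[OF automorphism_translate[OF g] X] imageI[OF e, of "map_prod ((<#) g) ((<#) g)"]
  by (simp add: translate_def)

text \<open>By \<open>A <#> H = A\<close> membership in \<open>A\<close> depends on the vertex only,
  and \<open>H_proper\<close> makes both sides infinite. An edge leaves the set at a vertex meeting
  \<open>A - (A #> s)\<close> for a generator \<open>s\<close> or the inverse of one, so almost
  invariance leaves finitely many initial vertices, each with finitely many neighbours.\<close>

lemma cut_left_cosets:
  assumes A: "A \<subseteq> carrier G" "H_proper G H A" "H_almost_invariant G H A" "A <#> H = A"
  shows "cut ((\<lambda>x. x <# H) ` A)"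
proof -
  let ?A = "(\<lambda>x. x <# H) ` A"
  have mem: "x <# H \<in> ?A \<longleftrightarrow> x \<in> A" if x: "x \<in> carrier G" for x
  proof
    assume "x <# H \<in> ?A"
    then obtain a where a: "a \<in> A" "x <# H = a <# H" by blast
    then have "x \<in> a <# H" using mem_lcoset_iff[OF H _ x] A(1) by auto
    then have "x \<in> A <#> H" using a by (auto simp: l_coset_def set_mult_def)
    then show "x \<in> A" using A(4) by simp
  qed simp
  have compl: "vertices - ?A = (\<lambda>x. x <# H) ` (carrier G - A)"
    using mem A(1) by (auto simp: vertices_def)
  have inf: "infinite ?A" "infinite (vertices - ?A)"
    unfolding compl using A(1,2) H_finite_left_cosets by (auto simp: H_proper_def)
  \<comment> \<open>Contains the initial vertices of all boundary edges: \<open>inv s\<close>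
    accounts for arcs traversed forwards, \<open>s\<close> for those traversed backwards.\<close>
  define T where "T = (\<Union>s\<in>S \<union> (\<lambda>s. inv s) ` S. (\<lambda>x. x <# H) ` (A - (A #> s)))"
  have "finite ((\<lambda>x. x <# H) ` (A - (A #> s)))" if s: "s \<in> carrier G" for s
  proof -
    have "H_finite G H (A - (A #> s))"
      using A(3) s unfolding H_almost_invariant_def H_finite_def by (meson le_sup_iff)
    then show ?thesis by (rule finite_left_cosets)
  qed
  then have "finite T" unfolding T_def using S_finite S_sub by (intro finite_UN_I) auto
  moreover have "T \<subseteq> vertices" using A(1) by (auto simp: T_def vertices_def)
  ultimately have T: "finite T" "T \<subseteq> vertices" by auto
  have "coboundary edges ?A \<subseteq> (SIGMA v:T. edges `` {v})"
  proof
    fix e assume "e \<in> coboundary edges ?A"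
    moreover obtain v w where vw: "e = (v, w)" by (cases e)
    ultimately have e: "(v, w) \<in> edges" "v \<in> ?A" "w \<notin> ?A"
      unfolding coboundary_def by (simp_all del: image_iff)
    from e(1) consider x s where "x \<in> carrier G" "s \<in> S" "v = x <# H" "w = (x \<otimes> s) <# H"
      | x s where "x \<in> carrier G" "s \<in> S" "v = (x \<otimes> s) <# H" "w = x <# H"
      unfolding edges_def arcs_def by blast
    then have "v \<in> T"
    proof cases
      case 1
      then have sG: "s \<in> carrier G" using S_sub by auto
      then have x: "x \<in> A" "x \<otimes> s \<notin> A" using 1 e mem[of x] mem[of "x \<otimes> s"] by auto
      have "x \<notin> A #> inv s"
      proof
        assume "x \<in> A #> inv s"
        then obtain a where "a \<in> A" "x = a \<otimes> inv s" by (auto simp: r_coset_def)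
        then show False using x(2) A(1) sG by (auto simp: m_assoc)
      qed
      then show ?thesis using 1 x unfolding T_def by blast
    next
      case 2
      then have sG: "s \<in> carrier G" using S_sub by auto
      then have x: "x \<otimes> s \<in> A" "x \<notin> A" using 2 e mem[of x] mem[of "x \<otimes> s"] by auto
      have "x \<otimes> s \<notin> A #> s"
      proof
        assume "x \<otimes> s \<in> A #> s"
        then obtain a where "a \<in> A" "x \<otimes> s = a \<otimes> s" by (auto simp: r_coset_def)
        then show False using x(2) A(1) sG 2 right_cancel[OF sG] by blast
      qed
      then show ?thesis using 2 x unfolding T_def by blast
    qed
    then show "e \<in> (SIGMA v:T. edges `` {v})" using e vw by auto
  qed
  moreover have "finite (SIGMA v:T. edges `` {v})" using T finite_neighbours by (intro finite_SigmaI) auto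
  ultimately have "finite (coboundary edges ?A)" by (rule finite_subset)
  moreover have "?A \<subseteq> vertices" using A(1) by (auto simp: vertices_def)
  ultimately show ?thesis using inf by (simp add: cut_def)
qed

text \<open>\<open>Y\<close> is infinite with finite coboundary, so it has a vertex \<open>v\<close>
  none of whose edges leaves \<open>Y\<close>. As \<open>G\<close> is transitive on vertices, a
  translate of \<open>X\<close> has a boundary edge starting at \<open>v\<close>; both ends of that
  edge lie in \<open>Y\<close>, and nestedness leaves only the two proper inclusions.\<close>

lemma optimal_inside:
  assumes X: "optimal X" and Y: "optimal Y" and e: "(H, b) \<in> coboundary edges X"
  obtains g where "g \<in> carrier G" "g \<cdot> X \<subset> Y \<or> vertices - g \<cdot> X \<subset> Y"
proof -
  have XV: "X \<subseteq> vertices" "Y \<subseteq> vertices" and Yc: "infinite Y" "finite (coboundary edges Y)"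
    using X Y by (auto simp: optimal_def min_cut_def cut_def)
  have "infinite (Y - fst ` coboundary edges Y)" using Yc by (simp add: Diff_infinite_finite)
  then obtain v where v: "v \<in> Y" "v \<notin> fst ` coboundary edges Y" by (metis Diff_iff all_not_in_conv finite.emptyI)
  then obtain g where g: "g \<in> carrier G" "v = g <# H" using XV vertex_cases by blast
  have e': "(v, g <# b) \<in> coboundary edges (g \<cdot> X)" using coboundary_translate[OF g(1) XV(1) e] g(2) by simp
  then have mem: "v \<in> g \<cdot> X" "g <# b \<notin> g \<cdot> X" "(v, g <# b) \<in> edges" by (auto simp: coboundary_def)
  have "g <# b \<in> Y" using mem(3) v by (force simp: coboundary_def)
  moreover have "nested vertices (g \<cdot> X) Y" using optimal_nested optimal_translate g X Y by blast
  ultimately have "g \<cdot> X \<subset> Y \<or> vertices - g \<cdot> X \<subset> Y"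
    using mem v(1) unfolding nested_def by blast
  then show ?thesis using that g by blast
qed

text \<open>Such a \<open>W\<close> separates a fixed point of \<open>Y\<close> from a fixed point
  outside \<open>Z\<close>, so it crosses one of the finitely many edges of a fixed path.\<close>

lemma optimal_interval_finite:
  assumes "optimal Y" "optimal Z"
  shows "finite {W. optimal W \<and> Y \<subseteq> W \<and> W \<subseteq> Z}"
proof -
  have YZ: "infinite Y" "Y \<subseteq> vertices" "infinite (vertices - Z)"
    using assms by (auto simp: optimal_def min_cut_def cut_def)
  obtain y where y: "y \<in> Y" using YZ(1) by fastforce
  obtain z where z: "z \<in> vertices" "z \<notin> Z" using YZ(3) by (metis Diff_iff all_not_in_conv finite.emptyI)
  have "(y, z) \<in> edges\<^sup>*" using connected y z YZ by blast
  then obtain F where F: "finite F" "F \<subseteq> edges" "(y, z) \<in> F\<^sup>*" by (rule rtrancl_finite_subset)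
  have "{W. optimal W \<and> Y \<subseteq> W \<and> W \<subseteq> Z} \<subseteq> (\<Union>e\<in>F. {W. min_cut W \<and> e \<in> coboundary edges W})"
  proof
    fix W assume W: "W \<in> {W. optimal W \<and> Y \<subseteq> W \<and> W \<subseteq> Z}"
    then obtain a b where ab: "(a, b) \<in> coboundary F W" using F(3) y z by (auto elim: rtrancl_crosses)
    then have "(a, b) \<in> coboundary edges W" "(a, b) \<in> F" using F(2) by (auto simp: coboundary_def)
    then show "W \<in> (\<Union>e\<in>F. {W. min_cut W \<and> e \<in> coboundary edges W})" using W by (auto simp: optimal_def)
  qed
  then show ?thesis using F(1) finite_min_cuts_edge by (meson finite_UN_I finite_subset)
qed

theorem splitting_from_cut:
  assumes "cut C"
  shows "\<exists>K. subgroup K G \<and> commensurable G K H \<and> splits_nontrivially_over G K"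
proof -
  obtain X' where X': "optimal X'" using optimal_exists assms by blast
  have X'V: "X' \<subseteq> vertices" "X' \<noteq> {}" "X' \<noteq> vertices"
    using X' by (auto simp: optimal_def min_cut_def cut_def)
  then obtain a b' where ab: "(a, b') \<in> coboundary edges X'"
    using coboundary_nonempty[OF X'V] by (metis ex_in_conv surj_pair)
  then have "a \<in> vertices" using X'V by (auto simp: coboundary_def)
  then obtain x where x: "x \<in> carrier G" "a = x <# H" by (rule vertex_cases)
  \<comment> \<open>Translated so that a boundary edge starts at the vertex \<open>H\<close>:
    otherwise the edge stabilizer would be compared with a conjugate of \<open>H\<close>.\<close>
  define X where "X = inv x \<cdot> X'"
  define b where "b = inv x <# b'"
  have X: "optimal X" using X' x optimal_translate by (simp add: X_def)
  have "inv x <# a = H" using x lcoset_mult[of "inv x" x] lcos_mult_one[OF H_sub] by simp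
  then have e: "(H, b) \<in> coboundary edges X"
    using coboundary_translate[OF _ X'V(1) ab, of "inv x"] x by (simp add: X_def b_def)
  have XV: "X \<subseteq> vertices" "infinite X" "infinite (vertices - X)" "finite (coboundary edges X)"
    using X by (auto simp: optimal_def min_cut_def cut_def)
  define EE where "EE = {g \<cdot> X | g. g \<in> carrier G} \<union> {vertices - g \<cdot> X | g. g \<in> carrier G}"
  have opt: "optimal Y" if "Y \<in> EE" for Y
    using that X optimal_translate optimal_compl by (auto simp: EE_def)
  interpret T: nested_translates G vertices "\<lambda>g v. g <# v" X EE
  proof unfold_locales
    show "nested vertices Y Z" if "Y \<in> EE" "Z \<in> EE" for Y Z 
      using optimal_nested[OF opt[OF that(1)] opt[OF that(2)]] .
    show "finite {W \<in> EE. Y \<subseteq> W \<and> W \<subseteq> Z}" if "Y \<in> EE" "Z \<in> EE" for Y Z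
      using optimal_interval_finite[OF opt[OF that(1)] opt[OF that(2)]]
      by (rule rev_finite_subset) (use opt in blast)
    show "X \<subseteq> vertices" "X \<noteq> {}" "X \<noteq> vertices" using XV by auto
  qed (rule EE_def)
  let ?K = T.edge_stabilizer
  have K: "subgroup ?K G" by (rule T.subgroup_edge_stabilizer)
  have KH: "subgroup (?K \<inter> H) G" using subgroups_Inter_pair K H by blast
  have inside: "\<exists>Z\<in>EE. Z \<subset> Y" if Y: "optimal Y" for Y
  proof -
    obtain g where "g \<in> carrier G" "g \<cdot> X \<subset> Y \<or> vertices - g \<cdot> X \<subset> Y"
      using optimal_inside[OF X Y e] .
    then show ?thesis using T.translate_X T.compl_translate_X by blast
  qed
  have "splits_nontrivially_over G ?K"
    using T.splits_over_edge_stabilizer[OF inside[OF optimal_compl[OF X]] inside[OF X]] .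
  moreover have "finite_index G (?K \<inter> H) ?K"
  proof (rule finite_indexI[OF K KH, where f = "\<lambda>k. inv k <# H"])
    \<comment> \<open>The edge stabilizer preserves the finite coboundary of \<open>X\<close>, so
      the vertex \<open>H\<close> has a finite orbit under it.\<close>
    have "(\<lambda>k. inv k <# H) ` ?K \<subseteq> fst ` coboundary edges X"
    proof
      fix v assume "v \<in> (\<lambda>k. inv k <# H) ` ?K"
      then obtain k where k: "k \<in> ?K" "v = inv k <# H" by blast
      then have "inv k \<in> ?K" using subgroup.m_inv_closed[OF K] by blast
      then have "inv k \<in> carrier G" "inv k \<cdot> X = X" by (auto simp: T.edge_stabilizer_def)
      then have "(v, inv k <# b) \<in> coboundary edges X" using coboundary_translate[OF _ XV(1) e] k by metis
      then show "v \<in> fst ` coboundary edges X" by force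
    qed
    then show "finite ((\<lambda>k. inv k <# H) ` ?K)" using XV(4) finite_surj by blast
    fix k l assume kl: "k \<in> ?K" "l \<in> ?K" "inv k <# H = inv l <# H"
    then have "k \<in> carrier G" "l \<in> carrier G" by (auto simp: T.edge_stabilizer_def)
    then have "k \<otimes> inv l \<in> H" using kl(3) lcoset_eq_iff[OF H, of "inv k" "inv l"] by simp
    then show "k \<otimes> inv l \<in> ?K \<inter> H"
      using kl subgroup.m_closed[OF K] subgroup.m_inv_closed[OF K] by blast
  qed blast
  moreover have "finite_index G (?K \<inter> H) H"
  proof (rule finite_indexI[OF H KH, where f = "\<lambda>h. inv h \<cdot> X"])
    \<comment> \<open>\<open>H\<close> fixes its own vertex, so it moves \<open>X\<close> only to
      minimal cuts with a boundary edge starting there, and finitely many edges start at that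
      vertex.\<close>
    have "(\<lambda>h. inv h \<cdot> X) ` H \<subseteq> (\<Union>w\<in>edges `` {H}. {Y. min_cut Y \<and> (H, w) \<in> coboundary edges Y})"
    proof
      fix Y assume "Y \<in> (\<lambda>h. inv h \<cdot> X) ` H"
      then obtain h where h: "h \<in> H" "Y = inv h \<cdot> X" by blast
      then have hG: "inv h \<in> H" "inv h \<in> carrier G" using subgroup.m_inv_closed[OF H] H_sub by auto
      then have "inv h <# H = H" using coset_join3[OF _ H] by blast
      then have "(H, inv h <# b) \<in> coboundary edges Y"
        using coboundary_translate[OF hG(2) XV(1) e] h by simp
      moreover have "min_cut Y" using optimal_translate[OF hG(2) X] h by (simp add: optimal_def)
      ultimately show "Y \<in> (\<Union>w\<in>edges `` {H}. {Y. min_cut Y \<and> (H, w) \<in> coboundary edges Y})"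
        by (auto simp: coboundary_def)
    qed
    moreover have "finite (\<Union>w\<in>edges `` {H}. {Y. min_cut Y \<and> (H, w) \<in> coboundary edges Y})"
      using finite_neighbours[OF H_vertex] finite_min_cuts_edge by blast
    ultimately show "finite ((\<lambda>h. inv h \<cdot> X) ` H)" by (rule finite_subset)
    fix h k assume hk: "h \<in> H" "k \<in> H" "inv h \<cdot> X = inv k \<cdot> X"
    then have "h \<in> carrier G" "k \<in> carrier G" using H_sub by auto
    then have "h \<otimes> inv k \<in> ?K" using hk(3) T.edge_stabilizer_iff[of "inv h" "inv k"] by simp
    then show "h \<otimes> inv k \<in> ?K \<inter> H"
      using hk subgroup.m_closed[OF H] subgroup.m_inv_closed[OF H] by blast
  qed blast
  ultimately show ?thesis using K by (auto simp: commensurable_def)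
qed

end

theorem theorem2p7:
  fixes G :: "('a, 'b) monoid_scheme" (structure)
    and H A :: "'a set"
  assumes "finitely_generated_group G"
    and "commensurated G H"
    and "A \<subseteq> carrier G"
    and "H_proper G H A"
    and "H_almost_invariant G H A"
    and "A <#> H = A"
  shows "\<exists>C. subgroup C G \<and> commensurable G C H \<and> splits_nontrivially_over G C"
proof -
  obtain S where S: "group G" "finite S" "S \<subseteq> carrier G" "generate G S = carrier G"
    using assms(1) by (auto simp: finitely_generated_group_def)
  interpret group G by (rule S(1))
  interpret generated_commensurated G H S
    by unfold_locales (use S assms(2) in auto)
  show ?thesis using splitting_from_cut cut_left_cosets assms(3-6) by blast
qed

end
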